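(* Let $E$ and $F$ be Banach lattices, with $F'$ the dual of $F$. Then the following hold. (1) Let $T:E\to F$ be a positive operator. If $F$ has order continuous norm, then the following conditions are equivalent. (a) $T$ is L-weakly compact. (b) $y'_n(Tx_n)\to 0$ for each positive disjoint sequence $(x_n)\subset B_E$ and every bounded $uaw^*$-null sequence $(y'_n)$ in $F'$. (c) $y'_n(Tx_n)\to 0$ for each positive disjoint sequence $(x_n)\subset B_E$ and every bounded $uaw$-null sequence $(y'_n)$ in $F'$. (d) $y'_n(Tx_n)\to 0$ for each positive disjoint sequence $(x_n)\subset B_E$ and every bounded $uo$-null sequence $(y'_n)$ in $F'$. (2) Let $S:E\to F'$ be a positive operator. If $F'$ has order continuous norm, then $S$ is L-weakly compact if and only if $(Sx_n)(y_n)\to 0$ for each positive disjoint sequence $(x_n)$ in $B_E$ and every bounded $uaw$-null sequence $(y_n)$ in $F$.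
   Context: $B_E$ is the closed unit ball of $E$. A (linear) operator $T$ is positive if $Tx\ge 0$ for all $x\ge 0$. A bounded subset $A$ of a Banach lattice is L-weakly compact if every disjoint sequence in the solid hull of $A$ converges to zero in norm (a sequence $(x_n)$ is disjoint if $|x_n|\wedge|x_m|=0$ for $n\neq m$). A continuous operator $T$ from a Banach space $E$ to a Banach lattice $G$ is L-weakly compact if $T(B_E)$ is an L-weakly compact subset of $G$. A net $(x_\alpha)$ in a Riesz space is order convergent to $x$ if there is a net $(y_\beta)$, possibly over a different index set, with $y_\beta\downarrow 0$ such that for each $\beta$ there is $\alpha_0$ with $|x_\alpha-x|\le y_\beta$ for all $\alpha\ge\alpha_0$. In a Banach lattice $G$, a net $(x_\alpha)$ is $uo$-convergent (unbounded order convergent), respectively $uaw$-convergent (unbounded absolute weakly convergent), to $x$ if for every $u\in G_+$ the net $|x_\alpha-x|\wedge u$ converges to $0$ in order, respectively weakly, i.e. in $\sigma(G,G')$. In a dual Banach lattice $F'$, a net $(y'_\alpha)$ is $uaw^*$-convergent (unbounded absolute weak* convergent) to $y'$ if $|y'_\alpha-y'|\wedge u'\to 0$ in $\sigma(F',F)$ for every $u'\in F'_+$. A sequence is $uo$-, $uaw$- or $uaw^*$-null if it converges to $0$ in the respective sense. "Bounded" means norm bounded. *)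

theory Defs
  imports "HOL-Analysis.Analysis" "HOL-Library.Lattice_Algebras"
begin

section \<open>Banach lattices\<close>

class banach_lattice = banach + lattice_ab_group_add_abs + ordered_real_vector +
  assumes norm_mono_abs: "\<bar>x\<bar> \<le> \<bar>y\<bar> \<Longrightarrow> norm x \<le> norm y"

instance real :: banach_lattice
  by standard (auto simp: sup_max)

lemma norm_abs_bl [simp]: "norm \<bar>x\<bar> = norm (x::'a::banach_lattice)"
  by (simp add: norm_mono_abs order_antisym)

lemma norm_mono_bl: "0 \<le> x \<Longrightarrow> x \<le> y \<Longrightarrow> norm x \<le> norm (y::'a::banach_lattice)"
  by (intro norm_mono_abs) simp

lemma pprt_diff: "pprt x - pprt (- x) = (x::'a::lattice_ab_group_add)"
  using prts[of x] by (simp add: pprt_neg)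

lemma pprt_le_abs: "pprt x \<le> \<bar>x::'a::lattice_ab_group_add_abs\<bar>"
  by (simp add: pprt_def abs_ge_self)

lemma norm_pprt_le: "norm (pprt x) \<le> norm (x::'a::banach_lattice)"
  using norm_mono_bl[OF zero_le_pprt pprt_le_abs[of x]] by simp

section \<open>The dual Banach lattice\<close>

text \<open>The library type of bounded linear maps cannot be ordered as a lattice uniformly in its
  codomain, so the Banach dual is a copy of \<^typ>\<open>'a \<Rightarrow>\<^sub>L real\<close>, with the same norm.\<close>

typedef (overloaded) 'a dual = "UNIV :: ('a::real_normed_vector \<Rightarrow>\<^sub>L real) set"
  morphisms blinfun_of_dual Dual ..

setup_lifting type_definition_dual

lift_definition dual_apply :: "'a::real_normed_vector dual \<Rightarrow> 'a \<Rightarrow> real" is blinfun_apply .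

instantiation dual :: (real_normed_vector) real_normed_vector
begin

lift_definition norm_dual :: "'a dual \<Rightarrow> real" is norm .
lift_definition zero_dual :: "'a dual" is 0 .
lift_definition plus_dual :: "'a dual \<Rightarrow> 'a dual \<Rightarrow> 'a dual" is "(+)" .
lift_definition minus_dual :: "'a dual \<Rightarrow> 'a dual \<Rightarrow> 'a dual" is "(-)" .
lift_definition uminus_dual :: "'a dual \<Rightarrow> 'a dual" is "uminus" .
lift_definition scaleR_dual :: "real \<Rightarrow> 'a dual \<Rightarrow> 'a dual" is "scaleR" .

definition dist_dual :: "'a dual \<Rightarrow> 'a dual \<Rightarrow> real"
  where "dist_dual f g = norm (f - g)"

definition sgn_dual :: "'a dual \<Rightarrow> 'a dual"
  where "sgn_dual f = scaleR (inverse (norm f)) f"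

definition uniformity_dual :: "('a dual \<times> 'a dual) filter"
  where "uniformity_dual = (INF e\<in>{0 <..}. principal {(x, y). dist x y < e})"

definition open_dual :: "'a dual set \<Rightarrow> bool"
  where "open_dual U = (\<forall>x\<in>U. \<forall>\<^sub>F (x', y) in uniformity. x' = x \<longrightarrow> y \<in> U)"

instance
proof
  fix f g h :: "'a dual" and a b :: real
  show "f + g + h = f + (g + h)" "f + g = g + f" "0 + f = f" "- f + f = 0" "f - g = f + - g"
    by (transfer, simp)+
  show "a *\<^sub>R (f + g) = a *\<^sub>R f + a *\<^sub>R g" "(a + b) *\<^sub>R f = a *\<^sub>R f + b *\<^sub>R f"
    by (transfer, simp add: scaleR_add_right scaleR_add_left)+
  show "a *\<^sub>R b *\<^sub>R f = (a * b) *\<^sub>R f" "1 *\<^sub>R f = f"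
    by (transfer, simp)+
  show "(norm f = 0) = (f = 0)" "norm (a *\<^sub>R f) = \<bar>a\<bar> * norm f"
    by (transfer, simp)+
  show "norm (f + g) \<le> norm f + norm g"
    by transfer (rule norm_triangle_ineq)
qed (rule dist_dual_def sgn_dual_def uniformity_dual_def open_dual_def)+

end

lemma norm_blinfun_of_dual: "norm (blinfun_of_dual f) = norm f"
  by transfer simp

lemma norm_Dual: "norm (Dual f) = norm f"
  by (simp add: norm_dual.abs_eq)

lemma Dual_diff: "Dual f - Dual g = Dual (f - g)"
  by (simp add: minus_dual.abs_eq)

lemma dual_apply_add: "dual_apply (f + g) x = dual_apply f x + dual_apply g x"
  by transfer (simp add: plus_blinfun.rep_eq)
lemma dual_apply_diff: "dual_apply (f - g) x = dual_apply f x - dual_apply g x"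
  by transfer (simp add: minus_blinfun.rep_eq)
lemma dual_apply_minus: "dual_apply (- f) x = - dual_apply f x"
  by transfer (simp add: uminus_blinfun.rep_eq)
lemma dual_apply_zero: "dual_apply 0 x = 0"
  by transfer simp
lemma dual_apply_scaleR: "dual_apply (c *\<^sub>R f) x = c * dual_apply f x"
  by transfer (simp add: scaleR_blinfun.rep_eq)
lemmas dual_apply_simps =
  dual_apply_add dual_apply_diff dual_apply_minus dual_apply_zero dual_apply_scaleR

lemma bounded_linear_dual_apply: "bounded_linear (dual_apply f)"
  by transfer (rule blinfun.bounded_linear_right)

lemma linear_dual_apply: "linear (dual_apply f)"
  by (rule bounded_linear.linear[OF bounded_linear_dual_apply])

lemma dual_eqI: "(\<And>x. dual_apply f x = dual_apply g x) \<Longrightarrow> f = g"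
  by transfer (rule blinfun_eqI)

lemma abs_dual_apply_le: "\<bar>dual_apply f x\<bar> \<le> norm f * norm x"
  by transfer (metis norm_blinfun real_norm_def)

lemma norm_dual_le: "0 \<le> b \<Longrightarrow> (\<And>x. \<bar>dual_apply f x\<bar> \<le> b * norm x) \<Longrightarrow> norm f \<le> b"
  by transfer (rule norm_blinfun_bound, simp_all)

lemma dual_of_bounded_linear:
  assumes "bounded_linear h"
  shows "dual_apply (Dual (Blinfun h)) = h"
  using assms by (simp add: dual_apply.abs_eq bounded_linear_Blinfun_apply)

instance dual :: (real_normed_vector) banach
proof
  fix X :: "nat \<Rightarrow> 'a dual"
  assume X: "Cauchy X"
  have "Cauchy (\<lambda>n. blinfun_of_dual (X n))"
    using X unfolding Cauchy_def dist_norm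
    by (simp flip: norm_blinfun_of_dual minus_dual.rep_eq)
  then obtain L where L: "(\<lambda>n. blinfun_of_dual (X n)) \<longlonglongrightarrow> L"
    using Cauchy_convergent convergent_def by blast
  have "norm (X n - Dual L) = norm (blinfun_of_dual (X n) - L)" for n
    by (simp add: minus_dual.rep_eq Dual_inverse flip: norm_blinfun_of_dual)
  then have "X \<longlonglongrightarrow> Dual L"
    using L unfolding LIMSEQ_iff by simp
  then show "convergent X"
    by (auto simp: convergent_def)
qed

subsection \<open>Positive part of a functional (Riesz-Kantorovich)\<close>

definition rk :: "'a::banach_lattice dual \<Rightarrow> 'a \<Rightarrow> real"
  where "rk f x = (SUP y\<in>{0..x}. dual_apply f y)"

definition dual_pprt :: "'a::banach_lattice dual \<Rightarrow> 'a dual"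
  where "dual_pprt f = Dual (Blinfun (\<lambda>x. rk f (pprt x) - rk f (pprt (- x))))"

lemma rk_bound: "(y::'a::banach_lattice) \<in> {0..x} \<Longrightarrow> dual_apply f y \<le> norm f * norm x"
  using abs_dual_apply_le[of f y] mult_left_mono[OF norm_mono_bl[of y x], of "norm f"]
  by fastforce

lemma rk_upper: "0 \<le> y \<Longrightarrow> y \<le> x \<Longrightarrow> dual_apply f y \<le> rk f x"
  unfolding rk_def
  by (rule cSUP_upper) (auto intro!: bdd_aboveI2 rk_bound)

lemma rk_least: "0 \<le> x \<Longrightarrow> (\<And>y. 0 \<le> y \<Longrightarrow> y \<le> x \<Longrightarrow> dual_apply f y \<le> c) \<Longrightarrow> rk f x \<le> c"
  unfolding rk_def by (rule cSUP_least) auto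

lemma rk_nonneg: "0 \<le> x \<Longrightarrow> 0 \<le> rk f x"
  using rk_upper[of 0 x f] by (simp add: linear_0[OF linear_dual_apply])

lemma rk_le_norm: "0 \<le> x \<Longrightarrow> rk f x \<le> norm f * norm x"
  by (rule rk_least) (auto intro: rk_bound)

lemma rk_add:
  assumes x: "0 \<le> x" and z: "0 \<le> z"
  shows "rk f (x + z) = rk f x + rk f z"
proof (rule antisym)
  show "rk f (x + z) \<le> rk f x + rk f z"
  proof (rule rk_least)
    fix y assume y: "0 \<le> y" "y \<le> x + z"
    let ?a = "inf y x"
    have "y - ?a = sup 0 (y - x)"
      by (simp add: add_sup_distrib_left)
    then have "0 \<le> y - ?a" "y - ?a \<le> z"
      using y z by (simp_all add: algebra_simps)
    then have "dual_apply f ?a \<le> rk f x" "dual_apply f (y - ?a) \<le> rk f z"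
      using x y by (intro rk_upper; simp)+
    then show "dual_apply f y \<le> rk f x + rk f z"
      by (simp add: linear_diff[OF linear_dual_apply] del: diff_inf_eq_sup)
  qed (use x z in simp)
  have "dual_apply f a + dual_apply f b \<le> rk f (x + z)"
    if "0 \<le> a" "a \<le> x" "0 \<le> b" "b \<le> z" for a b
    using rk_upper[of "a + b" "x + z" f] that
    by (simp add: linear_add[OF linear_dual_apply] add_mono)
  then have "rk f x \<le> rk f (x + z) - dual_apply f b" if "0 \<le> b" "b \<le> z" for b
    using that x by (intro rk_least) (auto simp: algebra_simps)
  then have "rk f z \<le> rk f (x + z) - rk f x"
    using z by (intro rk_least) (auto simp: algebra_simps)
  then show "rk f x + rk f z \<le> rk f (x + z)"
    by simp
qed

lemma rk_scaleR:
  assumes c: "0 \<le> c" and x: "0 \<le> x"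
  shows "rk f (c *\<^sub>R x) = c * rk f x"
proof (cases "c = 0")
  case True
  have "rk f 0 = 0"
    using rk_add[of 0 0 f] by simp
  then show ?thesis using True by simp
next
  case False
  have le: "rk f (d *\<^sub>R w) \<le> d * rk f w" if d: "0 < d" and w: "0 \<le> w" for d w
  proof (rule rk_least)
    fix y assume y: "0 \<le> y" "y \<le> d *\<^sub>R w"
    have "inverse d *\<^sub>R y \<le> inverse d *\<^sub>R d *\<^sub>R w"
      using y d by (intro scaleR_left_mono) auto
    then have "dual_apply f (inverse d *\<^sub>R y) \<le> rk f w"
      using y d by (intro rk_upper) (auto intro: scaleR_nonneg_nonneg)
    then show "dual_apply f y \<le> d * rk f w"
      using d by (simp add: linear_scale[OF linear_dual_apply] field_simps)
  qed (use d w in \<open>auto intro: scaleR_nonneg_nonneg\<close>)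
  from False c have c': "0 < c" by simp
  have "rk f (inverse c *\<^sub>R c *\<^sub>R x) \<le> inverse c * rk f (c *\<^sub>R x)"
    using c' x by (intro le) (auto intro: scaleR_nonneg_nonneg)
  then have "c * rk f x \<le> rk f (c *\<^sub>R x)"
    using c' by (simp add: field_simps)
  with le[OF c' x] show ?thesis by simp
qed

lemma rk_diff:
  assumes "0 \<le> u" "0 \<le> v"
  shows "rk f (pprt (u - v)) - rk f (pprt (- (u - v))) = rk f u - rk f v"
proof -
  have "pprt (u - v) + v = u + pprt (- (u - v))"
    using pprt_diff[of "u - v"] by (simp add: algebra_simps)
  then have "rk f (pprt (u - v) + v) = rk f (u + pprt (- (u - v)))"
    by simp
  then show ?thesis
    using assms by (simp add: rk_add del: minus_diff_eq)
qed

lemma dual_pprt_bounded_linear: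
  "bounded_linear (\<lambda>x. rk f (pprt x) - rk f (pprt (- x)))" (is "bounded_linear ?h")
proof (rule bounded_linear_intro[where K = "2 * norm f"])
  fix x z :: 'a and c :: real
  have "x + z = (pprt x + pprt z) - (pprt (- x) + pprt (- z))"
    using pprt_diff[of x] pprt_diff[of z] by (metis add_diff_add)
  then have "?h (x + z) = rk f (pprt x + pprt z) - rk f (pprt (- x) + pprt (- z))"
    by (metis rk_diff add_nonneg_nonneg zero_le_pprt)
  then show "?h (x + z) = ?h x + ?h z"
    by (simp add: rk_add)
  have pos: "?h (d *\<^sub>R w) = d * ?h w" if "0 \<le> d" for d w
  proof -
    have "d *\<^sub>R w = d *\<^sub>R pprt w - d *\<^sub>R pprt (- w)"
      by (metis pprt_diff scaleR_right_diff_distrib)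
    then have "?h (d *\<^sub>R w) = rk f (d *\<^sub>R pprt w) - rk f (d *\<^sub>R pprt (- w))"
      by (metis rk_diff scaleR_nonneg_nonneg that zero_le_pprt)
    then show ?thesis
      using that by (simp add: rk_scaleR algebra_simps)
  qed
  show "?h (c *\<^sub>R x) = c *\<^sub>R ?h x"
  proof (cases "0 \<le> c")
    case True
    then show ?thesis using pos by simp
  next
    case False
    then have "?h ((- c) *\<^sub>R (- x)) = (- c) * ?h (- x)"
      by (intro pos) simp
    then show ?thesis by (simp add: algebra_simps)
  qed
  have "rk f (pprt x) \<le> norm f * norm x" "rk f (pprt (- x)) \<le> norm f * norm x"
    using rk_le_norm[of "pprt x" f] rk_le_norm[of "pprt (- x)" f]
      mult_left_mono[OF norm_pprt_le[of x], of "norm f"]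
      mult_left_mono[OF norm_pprt_le[of "- x"], of "norm f"] by auto
  moreover have "0 \<le> rk f (pprt x)" "0 \<le> rk f (pprt (- x))"
    by (simp_all add: rk_nonneg)
  ultimately show "norm (?h x) \<le> norm x * (2 * norm f)"
    by (simp add: abs_le_iff algebra_simps)
qed

lemma dual_pprt_apply: "0 \<le> x \<Longrightarrow> dual_apply (dual_pprt f) x = rk f x"
  using rk_add[of 0 0 f]
  by (simp add: dual_pprt_def dual_of_bounded_linear[OF dual_pprt_bounded_linear])

text \<open>The dual is ordered by its positive cone; suprema, infima and absolute values with respect
  to this order are then given by the Riesz-Kantorovich formula.\<close>

instantiation dual :: (banach_lattice) banach_lattice
begin

definition less_eq_dual :: "'a dual \<Rightarrow> 'a dual \<Rightarrow> bool"
  where "f \<le> g \<longleftrightarrow> (\<forall>x\<ge>0. dual_apply f x \<le> dual_apply g x)"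

definition less_dual :: "'a dual \<Rightarrow> 'a dual \<Rightarrow> bool"
  where "f < g \<longleftrightarrow> f \<le> g \<and> \<not> g \<le> f" for f g :: "'a dual"

definition sup_dual :: "'a dual \<Rightarrow> 'a dual \<Rightarrow> 'a dual"
  where "sup_dual f g = f + dual_pprt (g - f)"

definition inf_dual :: "'a dual \<Rightarrow> 'a dual \<Rightarrow> 'a dual"
  where "inf_dual f g = - sup (- f) (- g)"

definition abs_dual :: "'a dual \<Rightarrow> 'a dual"
  where "abs_dual f = sup f (- f)"

instance
proof
  fix f g h :: "'a dual" and a b :: real
  show "f < g \<longleftrightarrow> f \<le> g \<and> \<not> g \<le> f"
    by (rule less_dual_def)
  show "f \<le> f" "f \<le> g \<Longrightarrow> g \<le> h \<Longrightarrow> f \<le> h"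
    by (auto simp: less_eq_dual_def intro: order_trans)
  show "f = g" if "f \<le> g" "g \<le> f"
  proof (rule dual_eqI)
    fix x
    have "dual_apply f y = dual_apply g y" if "0 \<le> y" for y
      using that \<open>f \<le> g\<close> \<open>g \<le> f\<close> by (simp add: less_eq_dual_def order_antisym)
    then have "dual_apply f (pprt x - pprt (- x)) = dual_apply g (pprt x - pprt (- x))"
      by (simp add: linear_diff[OF linear_dual_apply])
    then show "dual_apply f x = dual_apply g x"
      by (simp add: pprt_diff)
  qed
  have s1: "f \<le> sup f g" for f g :: "'a dual"
    by (simp add: less_eq_dual_def sup_dual_def dual_apply_simps dual_pprt_apply rk_nonneg)
  have s2: "g \<le> sup f g" for f g :: "'a dual"
    using rk_upper[of _ _ "g - f", OF _ order_refl]
    by (simp add: less_eq_dual_def sup_dual_def dual_apply_simps dual_pprt_apply algebra_simps)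
  have s3: "sup g h \<le> f" if "g \<le> f" "h \<le> f" for f g h :: "'a dual"
    unfolding less_eq_dual_def
  proof safe
    fix x :: 'a assume x: "0 \<le> x"
    have "rk (h - g) x \<le> dual_apply (f - g) x"
    proof (rule rk_least[OF x])
      fix y assume y: "0 \<le> y" "y \<le> x"
      have "dual_apply g (x - y) \<le> dual_apply f (x - y)"
        using y that by (simp add: less_eq_dual_def)
      moreover have "dual_apply h y \<le> dual_apply f y"
        using y that by (simp add: less_eq_dual_def)
      ultimately show "dual_apply (h - g) y \<le> dual_apply (f - g) x"
        by (simp add: dual_apply_simps linear_diff[OF linear_dual_apply])
    qed
    then show "dual_apply (sup g h) x \<le> dual_apply f x"
      using x by (simp add: sup_dual_def dual_apply_simps dual_pprt_apply)
  qed
  have neg: "- f \<le> - g \<longleftrightarrow> g \<le> f" for f g :: "'a dual"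
    by (auto simp: less_eq_dual_def dual_apply_simps)
  show "f \<le> sup f g" "g \<le> sup f g" by (rule s1, rule s2)
  show "g \<le> f \<Longrightarrow> h \<le> f \<Longrightarrow> sup g h \<le> f" by (rule s3)
  show "inf f g \<le> f" "inf f g \<le> g"
    using neg[of f "inf f g"] neg[of g "inf f g"] s1[of "- f" "- g"] s2[of "- g" "- f"]
    by (simp_all add: inf_dual_def)
  show "f \<le> g \<Longrightarrow> f \<le> h \<Longrightarrow> f \<le> inf g h"
    using neg[of "inf g h" f] neg[of f g] neg[of f h] neg[of g f] neg[of h f]
      s3[of "- g" "- f" "- h"]
    by (simp add: inf_dual_def)
  show "\<bar>f\<bar> = sup f (- f)"
    by (rule abs_dual_def)
  show "f \<le> g \<Longrightarrow> h + f \<le> h + g"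
    by (simp add: less_eq_dual_def dual_apply_simps)
  show "f \<le> g \<Longrightarrow> 0 \<le> a \<Longrightarrow> a *\<^sub>R f \<le> a *\<^sub>R g"
    by (simp add: less_eq_dual_def dual_apply_simps mult_left_mono)
  show "a \<le> b \<Longrightarrow> 0 \<le> f \<Longrightarrow> a *\<^sub>R f \<le> b *\<^sub>R f"
    by (simp add: less_eq_dual_def dual_apply_simps mult_right_mono)
  have abs_bound: "dual_apply \<bar>g\<bar> u \<le> norm g * norm u" if u: "0 \<le> u" for g :: "'a dual" and u
  proof -
    have "rk (- g - g) u \<le> norm g * norm u - dual_apply g u"
    proof (rule rk_least[OF u])
      fix y assume y: "0 \<le> y" "y \<le> u"
      have "u - y - y \<le> u" "- (u - y - y) \<le> u"
        using y by (simp_all add: algebra_simps)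
          (metis add_increasing add_mono order_trans le_add_same_cancel2)+
      then have "norm (u - y - y) \<le> norm u"
        using u by (intro norm_mono_abs) (simp add: abs_leI)
      then have "dual_apply g (u - y - y) \<le> norm g * norm u"
        using abs_dual_apply_le[of g "u - y - y"]
          mult_left_mono[of "norm (u - y - y)" "norm u" "norm g"] by simp
      then show "dual_apply (- g - g) y \<le> norm g * norm u - dual_apply g u"
        by (simp add: dual_apply_simps linear_diff[OF linear_dual_apply])
    qed
    then show ?thesis
      using u by (simp add: abs_dual_def sup_dual_def dual_apply_simps dual_pprt_apply)
  qed
  show "norm f \<le> norm g" if fg: "\<bar>f\<bar> \<le> \<bar>g\<bar>"
  proof (rule norm_dual_le)
    fix x
    have f1: "f \<le> \<bar>f\<bar>" and f2: "- f \<le> \<bar>f\<bar>"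
      unfolding abs_dual_def by (rule s1, rule s2)
    have pos: "\<bar>dual_apply f u\<bar> \<le> dual_apply \<bar>f\<bar> u" if "0 \<le> u" for u
      using f1 f2 that by (auto simp: less_eq_dual_def dual_apply_simps abs_le_iff)
    have "dual_apply f x = dual_apply f (pprt x) - dual_apply f (pprt (- x))"
      by (simp flip: linear_diff[OF linear_dual_apply] add: pprt_diff)
    then have "\<bar>dual_apply f x\<bar> \<le> dual_apply \<bar>f\<bar> (pprt x) + dual_apply \<bar>f\<bar> (pprt (- x))"
      using pos[of "pprt x"] pos[of "pprt (- x)"] by simp
    also have "\<dots> = dual_apply \<bar>f\<bar> \<bar>x\<bar>"
      by (simp flip: linear_add[OF linear_dual_apply] add: abs_prts pprt_neg)
    also have "\<dots> \<le> dual_apply \<bar>g\<bar> \<bar>x\<bar>"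
      using fg by (simp add: less_eq_dual_def)
    also have "\<dots> \<le> norm g * norm x"
      using abs_bound[of "\<bar>x\<bar>" g] by simp
    finally show "\<bar>dual_apply f x\<bar> \<le> norm g * norm x" .
  qed simp
qed

end

section \<open>Nets\<close>

definition directed_set :: "'i set \<Rightarrow> ('i \<Rightarrow> 'i \<Rightarrow> bool) \<Rightarrow> bool"
  where "directed_set B le \<longleftrightarrow> B \<noteq> {} \<and> (\<forall>a\<in>B. le a a) \<and>
    (\<forall>a\<in>B. \<forall>b\<in>B. \<forall>c\<in>B. le a b \<longrightarrow> le b c \<longrightarrow> le a c) \<and>
    (\<forall>a\<in>B. \<forall>b\<in>B. \<exists>c\<in>B. le a c \<and> le b c)"

text \<open>\<open>y\<^sub>\<beta> \<down> 0\<close>: the net is decreasing with infimum 0.\<close>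

definition net_decreases_to_0 ::
    "'i set \<Rightarrow> ('i \<Rightarrow> 'i \<Rightarrow> bool) \<Rightarrow> ('i \<Rightarrow> 'g::banach_lattice) \<Rightarrow> bool"
  where "net_decreases_to_0 B le y \<longleftrightarrow> directed_set B le \<and>
    (\<forall>a\<in>B. \<forall>b\<in>B. le a b \<longrightarrow> y b \<le> y a) \<and>
    (\<forall>b\<in>B. 0 \<le> y b) \<and> (\<forall>z. (\<forall>b\<in>B. z \<le> y b) \<longrightarrow> z \<le> 0)"

text \<open>HOL cannot quantify over index sets in all types. In the next two definitions the index
  sets of the decreasing nets are subsets of the lattice itself. This is no restriction, since
  a decreasing net can be reindexed by its own range; see the lemmas
  \<open>order_continuous_norm_any_index\<close> and \<open>order_convergent_any_index\<close>.\<close>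

definition order_continuous_norm :: "'g::banach_lattice itself \<Rightarrow> bool"
  where "order_continuous_norm _ \<longleftrightarrow>
    (\<forall>(B::'g set) le (y::'g \<Rightarrow> 'g). net_decreases_to_0 B le y \<longrightarrow>
      (\<forall>e>0. \<exists>a\<in>B. \<forall>b\<in>B. le a b \<longrightarrow> norm (y b) < e))"

text \<open>The convergent nets are given by a family together with a filter on its index type: for a
  directed index set this is the filter of its tails, for sequences \<^term>\<open>sequentially\<close>.\<close>

definition order_convergent :: "('i \<Rightarrow> 'g::banach_lattice) \<Rightarrow> 'g \<Rightarrow> 'i filter \<Rightarrow> bool"
  where "order_convergent x l F \<longleftrightarrow>
    (\<exists>(B::'g set) le (y::'g \<Rightarrow> 'g). net_decreases_to_0 B le y \<and>
      (\<forall>b\<in>B. \<forall>\<^sub>F i in F. \<bar>x i - l\<bar> \<le> y b))"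

lemma net_decreases_to_0_range:
  assumes "net_decreases_to_0 B le y"
  shows "net_decreases_to_0 (y ` B) (\<ge>) (\<lambda>v. v)"
proof -
  have "\<exists>c\<in>B. y c \<le> y a \<and> y c \<le> y b" if "a \<in> B" "b \<in> B" for a b
    using assms that unfolding net_decreases_to_0_def directed_set_def by meson
  then show ?thesis
    using assms unfolding net_decreases_to_0_def directed_set_def
    by (auto simp only: ball_simps bex_simps image_is_empty order_refl intro: order_trans)
qed

lemma order_continuous_norm_any_index:
  fixes y :: "'i \<Rightarrow> 'g::banach_lattice"
  assumes oc: "order_continuous_norm TYPE('g)" and y: "net_decreases_to_0 B le y" and e: "0 < e"
  shows "\<exists>a\<in>B. \<forall>b\<in>B. le a b \<longrightarrow> norm (y b) < e"
proof -
  have "\<exists>v\<in>y ` B. \<forall>w\<in>y ` B. w \<le> v \<longrightarrow> norm w < e"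
    using oc[unfolded order_continuous_norm_def, rule_format, OF net_decreases_to_0_range[OF y] e] .
  then obtain a where a: "a \<in> B" "\<And>b. b \<in> B \<Longrightarrow> y b \<le> y a \<Longrightarrow> norm (y b) < e"
    by auto
  have "y b \<le> y a" if "b \<in> B" "le a b" for b
    using y a(1) that by (simp add: net_decreases_to_0_def)
  with a show ?thesis by blast
qed

lemma order_convergent_any_index:
  fixes y :: "'j \<Rightarrow> 'g::banach_lattice"
  assumes y: "net_decreases_to_0 B le y" and x: "\<forall>b\<in>B. \<forall>\<^sub>F i in F. \<bar>x i - l\<bar> \<le> y b"
  shows "order_convergent x l F"
  unfolding order_convergent_def
  by (intro exI conjI, rule net_decreases_to_0_range[OF y]) (use x in simp)

section \<open>Unbounded convergences\<close>

definition weakly_convergent :: "('i \<Rightarrow> 'g::real_normed_vector) \<Rightarrow> 'g \<Rightarrow> 'i filter \<Rightarrow> bool"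
  where "weakly_convergent x l F \<longleftrightarrow>
    (\<forall>g::'g dual. ((\<lambda>i. dual_apply g (x i)) \<longlongrightarrow> dual_apply g l) F)"

definition weak_star_convergent ::
    "('i \<Rightarrow> 'f::real_normed_vector dual) \<Rightarrow> 'f dual \<Rightarrow> 'i filter \<Rightarrow> bool"
  where "weak_star_convergent y l F \<longleftrightarrow>
    (\<forall>x. ((\<lambda>i. dual_apply (y i) x) \<longlongrightarrow> dual_apply l x) F)"

definition uo_convergent :: "('i \<Rightarrow> 'g::banach_lattice) \<Rightarrow> 'g \<Rightarrow> 'i filter \<Rightarrow> bool"
  where "uo_convergent x l F \<longleftrightarrow> (\<forall>u\<ge>0. order_convergent (\<lambda>i. inf \<bar>x i - l\<bar> u) 0 F)"

definition uaw_convergent :: "('i \<Rightarrow> 'g::banach_lattice) \<Rightarrow> 'g \<Rightarrow> 'i filter \<Rightarrow> bool"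
  where "uaw_convergent x l F \<longleftrightarrow> (\<forall>u\<ge>0. weakly_convergent (\<lambda>i. inf \<bar>x i - l\<bar> u) 0 F)"

definition uaw_star_convergent ::
    "('i \<Rightarrow> 'f::banach_lattice dual) \<Rightarrow> 'f dual \<Rightarrow> 'i filter \<Rightarrow> bool"
  where "uaw_star_convergent y l F \<longleftrightarrow>
    (\<forall>u\<ge>0. weak_star_convergent (\<lambda>i. inf \<bar>y i - l\<bar> u) 0 F)"

definition uo_null :: "(nat \<Rightarrow> 'g::banach_lattice) \<Rightarrow> bool"
  where "uo_null x \<longleftrightarrow> uo_convergent x 0 sequentially"

definition uaw_null :: "(nat \<Rightarrow> 'g::banach_lattice) \<Rightarrow> bool"
  where "uaw_null x \<longleftrightarrow> uaw_convergent x 0 sequentially"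

definition uaw_star_null :: "(nat \<Rightarrow> 'f::banach_lattice dual) \<Rightarrow> bool"
  where "uaw_star_null y \<longleftrightarrow> uaw_star_convergent y 0 sequentially"

section \<open>L-weak compactness\<close>

definition disjoint_seq :: "(nat \<Rightarrow> 'g::banach_lattice) \<Rightarrow> bool"
  where "disjoint_seq x \<longleftrightarrow> (\<forall>n m. n \<noteq> m \<longrightarrow> inf \<bar>x n\<bar> \<bar>x m\<bar> = 0)"

definition solid :: "'g::banach_lattice set \<Rightarrow> bool"
  where "solid A \<longleftrightarrow> (\<forall>x y. \<bar>x\<bar> \<le> \<bar>y\<bar> \<longrightarrow> y \<in> A \<longrightarrow> x \<in> A)"

lemma mem_solid_hull: "x \<in> solid hull A \<longleftrightarrow> (\<exists>y\<in>A. \<bar>x\<bar> \<le> \<bar>y\<bar>)"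
proof -
  have "solid hull A = {x. \<exists>y\<in>A. \<bar>x\<bar> \<le> \<bar>y\<bar>}"
    by (rule hull_unique) (auto simp: solid_def intro: order_trans)
  then show ?thesis by simp
qed

definition L_weakly_compact_set :: "'g::banach_lattice set \<Rightarrow> bool"
  where "L_weakly_compact_set A \<longleftrightarrow> bounded A \<and>
    (\<forall>x. disjoint_seq x \<longrightarrow> range x \<subseteq> solid hull A \<longrightarrow> x \<longlonglongrightarrow> 0)"

definition L_weakly_compact :: "('e::banach \<Rightarrow> 'g::banach_lattice) \<Rightarrow> bool"
  where "L_weakly_compact T \<longleftrightarrow> bounded_linear T \<and> L_weakly_compact_set (T ` cball 0 1)"

definition positive_operator :: "('e::banach_lattice \<Rightarrow> 'g::banach_lattice) \<Rightarrow> bool"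
  where "positive_operator T \<longleftrightarrow> linear T \<and> (\<forall>x\<ge>0. 0 \<le> T x)"

definition pos_disjoint_ball_seq :: "(nat \<Rightarrow> 'e::banach_lattice) \<Rightarrow> bool"
  where "pos_disjoint_ball_seq x \<longleftrightarrow>
    (\<forall>n. 0 \<le> x n) \<and> disjoint_seq x \<and> range x \<subseteq> cball 0 1"

end

theory Submission
  imports Defs
begin

text \<open>Both parts concern a positive bilinear pairing of a Banach lattice \<open>G\<close> with order continuous norm
  (\<open>F\<close> or \<open>F'\<close>) and a Banach lattice \<open>H\<close> (\<open>F'\<close> or \<open>F\<close>). The recurrent device is disjoint splitting: a
  bounded positive sequence that keeps escaping from every fixed positive element has a
  subsequence whose escaping parts are disjoint up to a norm null error.

  Suppose that \<open>T\<close> is L-weakly compact and \<open>y n\<close> is unbounded null. Up to small norm, the images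
  \<open>T (x n)\<close> lie below one element \<open>u\<close>, so truncations of \<open>\<bar>y n\<bar>\<close> tend to 0 on them. If the whole
  pairing did not, splitting would produce a disjoint sequence in \<open>H\<close> that stays away from 0 on \<open>T (x n)\<close>,
  hence on \<open>u\<close>. Order continuity of the norm excludes that.

  Conversely, if \<open>T\<close> is not L-weakly compact, there are disjoint \<open>z n \<le> T (w n)\<close> with norms bounded
  below. One finds bounded disjoint \<open>h n\<close> in \<open>H\<close> whose pairing with \<open>z n\<close>, and hence with \<open>T (w n)\<close>, is bounded
  below: in part (1) by restricting norming functionals to the carriers of the \<open>z n\<close>, in part (2)
  by disjointifying elements on which the functionals \<open>z n\<close> almost attain their norms. Since \<open>h n\<close> is null
  on each fixed element, splitting replaces \<open>w n\<close> by a disjoint sequence, and disjoint sequences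
  are null in each of the three unbounded senses.\<close>

section \<open>Disjointness in Banach lattices\<close>

lemma inf_add_le:
  fixes a b c :: "'a::banach_lattice"
  assumes "0 \<le> a" "0 \<le> b" "0 \<le> c"
  shows "inf a (b + c) \<le> inf a b + inf a c"
proof -
  have "inf a (b + c) \<le> a + c" using assms by (simp add: le_infI1 add_increasing2)
  moreover have "inf a (b + c) \<le> b + c" by simp
  ultimately have 1: "inf a (b + c) \<le> inf a b + c"
    by (simp add: add_inf_distrib_right)
  have 2: "inf a (b + c) \<le> inf a b + a"
    using assms by (simp add: add_increasing le_infI1)
  from 1 2 show ?thesis by (simp add: add_inf_distrib_left)
qed

lemma disjoint_add:
  fixes a b c :: "'a::banach_lattice"
  assumes "0 \<le> a" "0 \<le> b" "0 \<le> c" "inf a b = 0" "inf a c = 0"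
  shows "inf a (b + c) = 0"
  using inf_add_le[of a b c] assms by (simp add: order_antisym)

lemma disjoint_mono:
  fixes a b :: "'a::banach_lattice"
  assumes "inf a b = 0" "0 \<le> a'" "a' \<le> a" "0 \<le> b'" "b' \<le> b"
  shows "inf a' b' = 0"
  using inf_mono[of a' a b' b] assms by (simp add: order_antisym)

lemma scaleR_right_mono_1:
  fixes a :: "'a::banach_lattice"
  assumes "0 \<le> a" "1 \<le> c" shows "a \<le> c *\<^sub>R a"
  using scaleR_right_mono[of 1 c a] assms by simp

lemma scaleR_inf_distrib:
  fixes a b :: "'a::banach_lattice"
  assumes c: "0 < c"
  shows "c *\<^sub>R inf a b = inf (c *\<^sub>R a) (c *\<^sub>R b)"
proof (rule antisym)
  show "c *\<^sub>R inf a b \<le> inf (c *\<^sub>R a) (c *\<^sub>R b)"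
    using c by (simp add: scaleR_left_mono)
  have "(1/c) *\<^sub>R inf (c *\<^sub>R a) (c *\<^sub>R b) \<le> (1/c) *\<^sub>R c *\<^sub>R a"
       "(1/c) *\<^sub>R inf (c *\<^sub>R a) (c *\<^sub>R b) \<le> (1/c) *\<^sub>R c *\<^sub>R b"
    using c by (intro scaleR_left_mono; simp)+
  then have "(1/c) *\<^sub>R inf (c *\<^sub>R a) (c *\<^sub>R b) \<le> inf a b" using c by simp
  then have "c *\<^sub>R (1/c) *\<^sub>R inf (c *\<^sub>R a) (c *\<^sub>R b) \<le> c *\<^sub>R inf a b"
    using c by (intro scaleR_left_mono) auto
  then show "inf (c *\<^sub>R a) (c *\<^sub>R b) \<le> c *\<^sub>R inf a b" using c by simp
qed

lemma scaleR_pprt: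
  fixes a :: "'a::banach_lattice"
  assumes c: "0 < c"
  shows "c *\<^sub>R pprt a = pprt (c *\<^sub>R a)"
proof -
  have "c *\<^sub>R sup a 0 = - (c *\<^sub>R inf (- a) 0)"
    by (subst sup_eq_neg_inf) (simp only: scaleR_minus_right minus_zero)
  also have "\<dots> = sup (c *\<^sub>R a) 0"
    by (subst sup_eq_neg_inf) (simp only: scaleR_inf_distrib[OF c] scaleR_minus_right minus_zero scaleR_zero_right)
  finally show ?thesis by (simp only: pprt_def)
qed

lemma disjoint_scaleR:
  fixes a b :: "'a::banach_lattice"
  assumes "0 \<le> a" "0 \<le> b" "inf a b = 0" "0 \<le> c"
  shows "inf a (c *\<^sub>R b) = 0"
proof -
  define C where "C = max c 1"
  have C: "0 < C" "1 \<le> C" "c \<le> C" by (auto simp: C_def)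
  have "inf (C *\<^sub>R a) (C *\<^sub>R b) = 0"
    using scaleR_inf_distrib[OF C(1), of a b] assms by simp
  then show ?thesis
    by (rule disjoint_mono)
      (use assms C in \<open>auto intro: scaleR_right_mono_1 scaleR_right_mono scaleR_nonneg_nonneg\<close>)
qed

lemma disjoint_pprt_neg:
  fixes a :: "'a::banach_lattice"
  shows "inf (pprt a) (pprt (- a)) = 0"
proof -
  have "inf (pprt a) (pprt (- a)) = inf a 0 + pprt (- a)"
    unfolding add_inf_distrib_right using pprt_diff[of a] by (simp add: algebra_simps)
  also have "inf a 0 = - pprt (- a)" by (simp add: pprt_neg nprt_def)
  finally show ?thesis by simp
qed

text \<open>Since \<open>(1/d) *\<^sub>R pprt (d *\<^sub>R p - q)\<close> is a multiple of the
  negative part of \<open>q - d *\<^sub>R p\<close>, it is disjoint from the positive part. It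
  equals \<open>pprt (p - (1/d) *\<^sub>R q)\<close>, which dominates the first element because
  \<open>c\<close> is at least \<open>1/d\<close>.\<close>

lemma disjoint_pprt_diff:
  fixes p q :: "'a::banach_lattice"
  assumes "0 \<le> p" "0 \<le> q" "0 < d" "1 \<le> c * d"
  shows "inf (pprt (p - c *\<^sub>R q)) (pprt (q - d *\<^sub>R p)) = 0"
proof -
  have "inf (pprt (q - d *\<^sub>R p)) (pprt (d *\<^sub>R p - q)) = 0"
    using disjoint_pprt_neg[of "q - d *\<^sub>R p"] by simp
  then have "inf (pprt (q - d *\<^sub>R p)) ((1/d) *\<^sub>R pprt (d *\<^sub>R p - q)) = 0"
    using assms by (intro disjoint_scaleR) auto
  then have "inf ((1/d) *\<^sub>R pprt (d *\<^sub>R p - q)) (pprt (q - d *\<^sub>R p)) = 0"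
    by (simp add: inf_commute)
  moreover have "(1/d) *\<^sub>R pprt (d *\<^sub>R p - q) = pprt (p - (1/d) *\<^sub>R q)"
    using assms scaleR_pprt[of "1/d" "d *\<^sub>R p - q"] by (simp add: scaleR_diff_right)
  moreover have "pprt (p - c *\<^sub>R q) \<le> pprt (p - (1/d) *\<^sub>R q)"
    using assms by (intro pprt_mono diff_left_mono scaleR_right_mono) (auto simp: field_simps)
  ultimately show ?thesis
    using disjoint_mono[of "pprt (p - (1/d) *\<^sub>R q)" "pprt (q - d *\<^sub>R p)"] by simp
qed

text \<open>Cuts \<open>a\<close> at the level \<open>b\<close> into a truncation and an excess,
  which the pairing estimates below treat separately.\<close>

lemma eq_inf_add_pprt:
  fixes a b :: "'a::banach_lattice"
  shows "a = inf a b + pprt (a - b)"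
proof -
  have "inf a b = a + inf 0 (b - a)" by (simp add: add_inf_distrib_left)
  also have "inf 0 (b - a) = - pprt (a - b)"
    using pprt_neg[of "b - a"] by (simp add: nprt_def inf_commute)
  finally show ?thesis by simp
qed

lemma pprt_leI: "x \<le> y \<Longrightarrow> 0 \<le> y \<Longrightarrow> pprt x \<le> (y::'a::banach_lattice)"
  by (simp add: pprt_def)

lemma le_pprt: "x \<le> pprt (x::'a::banach_lattice)"
  by (simp add: pprt_def)

section \<open>Closedness of the positive cone\<close>

text \<open>The negative part of the limit is dominated by \<open>\<bar>x n - l\<bar>\<close> as
  soon as \<open>x n\<close> is positive, so its norm is 0.\<close>

lemma nonneg_lim:
  fixes x :: "'i \<Rightarrow> 'a::banach_lattice"
  assumes "(x \<longlongrightarrow> l) F" "F \<noteq> bot" "eventually (\<lambda>n. 0 \<le> x n) F"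
  shows "0 \<le> l"
proof -
  have "((\<lambda>n. norm (x n - l)) \<longlongrightarrow> 0) F"
    using assms(1) by (simp add: LIM_zero tendsto_norm_zero)
  moreover have "eventually (\<lambda>n. norm (pprt (- l)) \<le> norm (x n - l)) F"
    using assms(3)
  proof eventually_elim
    case (elim n)
    have "- l \<le> x n - l" using elim by simp
    then have "- l \<le> \<bar>x n - l\<bar>" using abs_ge_self order_trans by blast
    then have "pprt (- l) \<le> \<bar>x n - l\<bar>" by (rule pprt_leI) simp
    then have "norm (pprt (- l)) \<le> norm \<bar>x n - l\<bar>"
      by (intro norm_mono_bl) auto
    then show ?case by simp
  qed
  ultimately have "norm (pprt (- l)) \<le> 0"
    using assms(2) by (intro tendsto_lowerbound) auto
  then have "pprt (- l) = 0" by simp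
  then show ?thesis using le_zero_iff_zero_pprt[of "- l"] by simp
qed

lemma lim_mono_bl:
  fixes x y :: "'i \<Rightarrow> 'a::banach_lattice"
  assumes "(x \<longlongrightarrow> l) F" "(y \<longlongrightarrow> m) F" "F \<noteq> bot" "eventually (\<lambda>n. x n \<le> y n) F"
  shows "l \<le> m"
  using nonneg_lim[OF tendsto_diff[OF assms(2,1)] assms(3)] assms(4) by simp

lemma le_suminf_bl:
  fixes t :: "nat \<Rightarrow> 'a::banach_lattice"
  assumes "summable t" "\<And>i. 0 \<le> t i"
  shows "t i \<le> suminf t"
proof (rule lim_mono_bl[OF tendsto_const[of "t i"]])
  show "(\<lambda>n. \<Sum>j<n. t j) \<longlonglongrightarrow> suminf t"
    using assms(1) by (rule summable_LIMSEQ)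
  show "\<forall>\<^sub>F n in sequentially. t i \<le> (\<Sum>j<n. t j)"
    using eventually_gt_at_top[of i]
  proof eventually_elim
    case (elim n)
    then show ?case using sum_mono2[of "{..<n}" "{i}" t] assms(2) by auto
  qed
qed simp

lemma archimedean_bl:
  fixes z y :: "'a::banach_lattice"
  assumes "\<And>k::nat. real k *\<^sub>R z \<le> y"
  shows "z \<le> 0"
proof -
  have *: "z \<le> inverse (real (Suc k)) *\<^sub>R y" for k
    using scaleR_left_mono[OF assms[of "Suc k"], of "inverse (real (Suc k))"] by simp
  have "(\<lambda>k. inverse (real (Suc k)) *\<^sub>R y) \<longlonglongrightarrow> 0 *\<^sub>R y"
    by (intro tendsto_scaleR LIMSEQ_inverse_real_of_nat tendsto_const)
  then show ?thesis
    by (intro lim_mono_bl[OF tendsto_const[of z]]) (use * in auto)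
qed

section \<open>Sums and sequences of disjoint elements\<close>

lemma disjoint_sum:
  fixes p :: "'i \<Rightarrow> 'a::banach_lattice"
  assumes "finite A" "0 \<le> a" "\<And>i. i \<in> A \<Longrightarrow> 0 \<le> p i \<and> inf a (p i) = 0"
  shows "inf a (sum p A) = 0"
  using assms
proof (induction A rule: finite_induct)
  case (insert x A)
  then show ?case by (auto intro!: disjoint_add sum_nonneg)
qed (simp add: inf_absorb2)

text \<open>Sums of disjoint positive elements are suprema, so a common upper bound of the terms
  also bounds the partial sums.\<close>

lemma disjoint_sum_le:
  fixes p :: "nat \<Rightarrow> 'a::banach_lattice"
  assumes "\<And>i. 0 \<le> p i" "\<And>i j. i \<noteq> j \<Longrightarrow> inf (p i) (p j) = 0" "\<And>i. p i \<le> u"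
  shows "(\<Sum>i<n. p i) \<le> u"
proof (induction n)
  case 0
  show ?case using assms(1,3)[of 0] by simp
next
  case (Suc n)
  have "inf (p n) (\<Sum>i<n. p i) = 0"
    using assms by (intro disjoint_sum) auto
  then have "p n + (\<Sum>i<n. p i) = sup (p n) (\<Sum>i<n. p i)"
    using add_eq_inf_sup[of "p n" "\<Sum>i<n. p i"] by simp
  also have "\<dots> \<le> u" using Suc assms by simp
  finally show ?case by (simp add: add.commute)
qed

lemma disjoint_seq_nonneg:
  "(\<And>n. 0 \<le> x n) \<Longrightarrow> disjoint_seq x \<longleftrightarrow> (\<forall>n m. n \<noteq> m \<longrightarrow> inf (x n) (x m) = 0)"
  by (simp add: disjoint_seq_def)

lemma disjoint_seq_subseq:
  "disjoint_seq x \<Longrightarrow> inj r \<Longrightarrow> disjoint_seq (\<lambda>n. x (r n))"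
  by (simp add: disjoint_seq_def inj_eq)

lemma disjoint_seq_dominated:
  assumes "disjoint_seq x" "\<And>n. \<bar>y n\<bar> \<le> \<bar>x n\<bar>"
  shows "disjoint_seq y"
  unfolding disjoint_seq_def
proof (intro allI impI)
  fix n m :: nat assume "n \<noteq> m"
  then have "inf \<bar>x n\<bar> \<bar>x m\<bar> = 0" using assms(1) by (simp add: disjoint_seq_def)
  then show "inf \<bar>y n\<bar> \<bar>y m\<bar> = 0" by (rule disjoint_mono) (simp_all add: assms(2))
qed

lemma disjoint_seqI:
  assumes "\<And>n. 0 \<le> x n" "\<And>n m. n < m \<Longrightarrow> inf (x n) (x m) = 0"
  shows "disjoint_seq x"
  unfolding disjoint_seq_nonneg[of x, OF assms(1)]
proof (intro allI impI)
  fix n m :: nat assume "n \<noteq> m"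
  then consider "n < m" | "m < n" by linarith
  then show "inf (x n) (x m) = 0" by cases (use assms(2) in \<open>simp, metis inf_commute\<close>)
qed

text \<open>From each chosen term, a large multiple of the earlier chosen terms and a small multiple
  of the later ones are subtracted. For two indices these factors have product at least 1, so
  \<open>disjoint_pprt_diff\<close> makes the remainders \<open>w\<close> disjoint. The first
  subtraction is \<open>v\<close>, for which \<open>Q\<close> holds by the choice of the index; the
  second is the null error \<open>e\<close>. In applications \<open>Q v n\<close> says that
  \<open>v\<close> accounts for only a part of the term with index \<open>n\<close>.\<close>

lemma disjoint_splitting:
  fixes x :: "nat \<Rightarrow> 'a::banach_lattice"
  assumes x: "\<And>n. 0 \<le> x n" and bdd: "bounded (range x)"
    and Q: "\<And>v. 0 \<le> v \<Longrightarrow> \<exists>\<^sub>F n in sequentially. Q v n"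
  obtains \<nu> w v e where "strict_mono \<nu>" "disjoint_seq w" "\<And>k. 0 \<le> w k" "\<And>k. w k \<le> x (\<nu> k)"
    "\<And>k. 0 \<le> v k" "\<And>k. Q (v k) (\<nu> k)" "\<And>k. 0 \<le> e k" "\<And>k. x (\<nu> k) \<le> v k + w k + e k"
    "e \<longlonglongrightarrow> 0"
proof -
  have pick: "\<exists>n\<ge>N. Q v n" if "0 \<le> v" for v N
    using Q[OF that] unfolding frequently_sequentially by blast
  \<comment> \<open>A state is the current index together with the sum of the terms chosen before
    it, so the next index can be chosen with that sum already known.\<close>
  let ?P = "\<lambda>k (p::nat \<times> 'a). 0 \<le> snd p \<and> Q (4 ^ k *\<^sub>R snd p) (fst p)"
  let ?R = "\<lambda>k (p::nat \<times> 'a) q. fst p < fst q \<and> snd q = snd p + x (fst p)"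
  obtain n0 where "Q 0 n0" using pick[of 0 0] by auto
  then have "\<exists>p. ?P 0 p" by (intro exI[of _ "(n0, 0)"]) auto
  moreover have "\<exists>q. ?P (Suc k) q \<and> ?R k p q" if "?P k p" for k p
  proof -
    have "0 \<le> snd p + x (fst p)" using that x by simp
    then obtain n where "n \<ge> Suc (fst p)" "Q (4 ^ Suc k *\<^sub>R (snd p + x (fst p))) n"
      using pick[of "4 ^ Suc k *\<^sub>R (snd p + x (fst p))"] by (auto simp: scaleR_nonneg_nonneg simp del: power_Suc)
    then show ?thesis
      using \<open>0 \<le> snd p + x (fst p)\<close> by (intro exI[of _ "(n, snd p + x (fst p))"]) auto
  qed
  ultimately obtain f where f: "\<And>k. ?P k (f k)" "\<And>k. ?R k (f k) (f (Suc k))"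
    using dependent_nat_choice[of ?P ?R] by blast
  define \<nu> where "\<nu> k = fst (f k)" for k
  define s where "s k = snd (f k)" for k
  have \<nu>: "strict_mono \<nu>" using f(2) by (simp add: strict_mono_Suc_iff \<nu>_def)
  have s0: "0 \<le> s k" and sQ: "Q (4 ^ k *\<^sub>R s k) (\<nu> k)" and sS: "s (Suc k) = s k + x (\<nu> k)" for k
    using f by (auto simp: s_def \<nu>_def)
  have s_ge: "x (\<nu> j) \<le> s k" if "j < k" for j k
    using that
  proof (induction k)
    case (Suc k)
    then show ?case using s0[of k] x[of "\<nu> k"] sS[of k]
      by (cases "j = k") (auto intro: add_increasing add_increasing2)
  qed simp
  obtain M where M: "\<And>n. norm (x n) \<le> M" using bdd by (auto simp: bounded_iff)
  \<comment> \<open>The weighted sum \<open>S\<close> dominates every \<open>t i\<close>. Hence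
    \<open>e k\<close>, a multiple of one fixed element, controls all terms chosen after
    \<open>k\<close> in advance and still tends to 0.\<close>
  define t where "t i = (1/2::real) ^ i *\<^sub>R x (\<nu> i)" for i
  have "summable t"
  proof (rule summable_comparison_test)
    show "\<exists>N. \<forall>n\<ge>N. norm (t n) \<le> M * (1/2) ^ n"
      using M by (auto simp: t_def mult.commute intro!: exI[of _ 0] mult_right_mono)
    show "summable (\<lambda>n. M * (1/2::real) ^ n)" by (intro summable_mult summable_geometric) simp
  qed
  define S where "S = suminf t"
  have t0: "0 \<le> t i" for i using x by (simp add: t_def scaleR_nonneg_nonneg)
  have tS: "t i \<le> S" for i
    unfolding S_def using \<open>summable t\<close> t0 by (rule le_suminf_bl)
  have S0: "0 \<le> S" using t0 tS order_trans by blast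
  define e where "e k = (1/2::real) ^ k *\<^sub>R S" for k
  define w where "w k = pprt (x (\<nu> k) - 4 ^ k *\<^sub>R s k - e k)" for k
  have e0: "0 \<le> e k" for k using S0 by (simp add: e_def scaleR_nonneg_nonneg)
  have "w k \<le> x (\<nu> k)" for k
  proof -
    have "0 \<le> 4 ^ k *\<^sub>R s k + e k" using e0 s0 by (intro add_nonneg_nonneg scaleR_nonneg_nonneg) auto
    then have "x (\<nu> k) - (4 ^ k *\<^sub>R s k + e k) \<le> x (\<nu> k) - 0" by (intro diff_left_mono)
    then show ?thesis unfolding w_def using x by (intro pprt_leI) (simp_all only: diff_diff_eq diff_zero)
  qed
  moreover have w0: "0 \<le> w k" for k by (simp add: w_def)
  moreover have "disjoint_seq w"
  proof (rule disjoint_seqI[OF w0])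
    fix j k :: nat assume "j < k"
    have "w j \<le> pprt (x (\<nu> j) - (1/2) ^ (j + k) *\<^sub>R x (\<nu> k))"
      unfolding w_def
    proof (rule pprt_mono)
      have "(1/2) ^ j *\<^sub>R t k \<le> e j"
        unfolding e_def by (intro scaleR_left_mono tS) auto
      then have "(1/2) ^ (j + k) *\<^sub>R x (\<nu> k) \<le> e j"
        by (simp add: t_def power_add)
      then show "x (\<nu> j) - 4 ^ j *\<^sub>R s j - e j \<le> x (\<nu> j) - (1/2) ^ (j + k) *\<^sub>R x (\<nu> k)"
        using s0[of j] by (simp add: algebra_simps add_increasing2 scaleR_nonneg_nonneg)
    qed
    moreover have "w k \<le> pprt (x (\<nu> k) - 4 ^ k *\<^sub>R x (\<nu> j))"
      unfolding w_def
    proof (rule pprt_mono)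
      have "(4::real) ^ k *\<^sub>R x (\<nu> j) \<le> 4 ^ k *\<^sub>R s k"
        by (intro scaleR_left_mono s_ge \<open>j < k\<close>) auto
      then show "x (\<nu> k) - 4 ^ k *\<^sub>R s k - e k \<le> x (\<nu> k) - 4 ^ k *\<^sub>R x (\<nu> j)"
        using e0[of k] by (simp add: algebra_simps add_increasing)
    qed
    moreover have "inf (pprt (x (\<nu> j) - (1/2) ^ (j + k) *\<^sub>R x (\<nu> k)))
        (pprt (x (\<nu> k) - 4 ^ k *\<^sub>R x (\<nu> j))) = 0"
    proof (rule disjoint_pprt_diff)
      have "(1/2::real) ^ (k + k) * 4 ^ k = 1"
        by (simp add: power_mult_distrib[symmetric] power_add)
      moreover have "(1/2::real) ^ (k + k) \<le> (1/2) ^ (j + k)"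
        using \<open>j < k\<close> by (intro power_decreasing) auto
      ultimately show "1 \<le> (1/2::real) ^ (j + k) * 4 ^ k"
        by (metis mult_right_mono zero_le_numeral zero_le_power)
    qed (use x in auto)
    ultimately show "inf (w j) (w k) = 0"
      using w0 disjoint_mono[OF _ w0 _ w0] by blast
  qed
  moreover have "x (\<nu> k) \<le> 4 ^ k *\<^sub>R s k + w k + e k" for k
    using le_pprt[of "x (\<nu> k) - 4 ^ k *\<^sub>R s k - e k"] by (simp add: w_def algebra_simps)
  moreover have "e \<longlonglongrightarrow> 0"
  proof -
    have "(\<lambda>k. (1/2::real) ^ k *\<^sub>R S) \<longlonglongrightarrow> 0 *\<^sub>R S"
      by (intro tendsto_scaleR LIMSEQ_realpow_zero tendsto_const) auto
    then show ?thesis by (simp add: e_def[abs_def])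
  qed
  ultimately show ?thesis
    using that[of \<nu> w "\<lambda>k. 4 ^ k *\<^sub>R s k" e] \<nu> s0 sQ e0 by (simp add: scaleR_nonneg_nonneg)
qed

section \<open>Order continuity, L-weak compactness and pairings\<close>

text \<open>The differences between upper bounds and terms of the sequence form a net decreasing to
  0: if \<open>z\<close> is below all of them, subtracting \<open>z\<close> from an upper bound
  gives an upper bound again, and the Archimedean property yields \<open>z \<le> 0\<close>. Order
  continuity then gives an upper bound close in norm to some \<open>X N\<close>, which makes the
  sequence Cauchy.\<close>

lemma oc_increasing_convergent:
  fixes X :: "nat \<Rightarrow> 'a::banach_lattice"
  assumes oc: "order_continuous_norm TYPE('a)"
    and inc: "\<And>n. X n \<le> X (Suc n)" and le: "\<And>n. X n \<le> u"
  shows "convergent X"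
proof -
  define B where "B = {y - X n | y n. \<forall>k. X k \<le> y}"
  have mono: "X m \<le> X n" if "m \<le> n" for m n
    using that by (rule lift_Suc_mono_le[of X, OF inc])
  have "net_decreases_to_0 B (\<lambda>a b. b \<le> a) (\<lambda>v. v)"
    unfolding net_decreases_to_0_def directed_set_def
  proof (intro conjI ballI allI impI)
    show "B \<noteq> {}" using le by (auto simp: B_def)
  next
    fix a b assume "a \<in> B" "b \<in> B"
    then obtain y n y' n' where a: "a = y - X n" "\<forall>k. X k \<le> y" and b: "b = y' - X n'" "\<forall>k. X k \<le> y'"
      by (auto simp: B_def)
    show "\<exists>c\<in>B. c \<le> a \<and> c \<le> b"
    proof (intro bexI conjI)
      show "inf y y' - X (max n n') \<le> a" "inf y y' - X (max n n') \<le> b"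
        unfolding a b by (intro diff_mono mono; simp)+
      show "inf y y' - X (max n n') \<in> B" using a b by (auto simp: B_def)
    qed
  next
    fix b assume "b \<in> B" then show "0 \<le> b" by (auto simp: B_def)
  next
    fix z assume z: "\<forall>b\<in>B. z \<le> b"
    have step: "\<forall>k. X k \<le> u - real m *\<^sub>R z" for m
    proof (induction m)
      case (Suc m)
      show ?case
      proof
        fix k
        have "z \<le> (u - real m *\<^sub>R z) - X k" using z Suc unfolding B_def by blast
        then show "X k \<le> u - real (Suc m) *\<^sub>R z" by (simp add: algebra_simps)
      qed
    qed (use le in simp)
    show "z \<le> 0"
    proof (rule archimedean_bl)
      fix m show "real m *\<^sub>R z \<le> u - X 0" using step[of m] by (simp add: algebra_simps)
    qed
  qed auto
  note net = this
  have "Cauchy X"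
  proof (rule metric_CauchyI)
    fix e :: real assume "0 < e"
    from order_continuous_norm_any_index[OF oc net this]
    obtain a where "a \<in> B" "norm a < e" by auto
    then obtain y N where y: "\<forall>k. X k \<le> y" "norm (y - X N) < e" by (auto simp: B_def)
    have main: "norm (X k - X m) < e" if "N \<le> m" "m \<le> k" for m k
    proof -
      have "norm (X k - X m) \<le> norm (y - X N)"
        using y mono[OF that(1)] mono[OF that(2)] by (intro norm_mono_bl) (auto intro: diff_mono)
      then show ?thesis using y by simp
    qed
    then show "\<exists>M. \<forall>m\<ge>M. \<forall>n\<ge>M. dist (X m) (X n) < e"
      by (intro exI[of _ N]) (metis dist_norm dist_commute nle_le)
  qed
  then show ?thesis by (rule Cauchy_convergent)
qed

text \<open>The partial sums increase and stay below \<open>u\<close>, so the series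
  converges.\<close>

lemma oc_order_bounded_disjoint_null:
  fixes p :: "nat \<Rightarrow> 'a::banach_lattice"
  assumes oc: "order_continuous_norm TYPE('a)"
    and p: "\<And>n. 0 \<le> p n" "disjoint_seq p" "\<And>n. p n \<le> u"
  shows "p \<longlonglongrightarrow> 0"
proof (rule summable_LIMSEQ_zero)
  have "convergent (\<lambda>n. \<Sum>i<n. p i)"
    by (rule oc_increasing_convergent[OF oc])
      (use p in \<open>auto intro!: disjoint_sum_le simp: disjoint_seq_nonneg\<close>)
  then show "summable p" by (simp add: summable_iff_convergent)
qed

section \<open>Positive operators and almost order boundedness\<close>

lemma positive_operatorD:
  assumes "positive_operator T"
  shows "linear T" "\<And>x. 0 \<le> x \<Longrightarrow> 0 \<le> T x" "\<And>x y. x \<le> y \<Longrightarrow> T x \<le> T y" "\<bar>T x\<bar> \<le> T \<bar>x\<bar>"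
proof -
  show lin: "linear T" and pos: "\<And>x. 0 \<le> x \<Longrightarrow> 0 \<le> T x"
    using assms by (auto simp: positive_operator_def)
  show mono: "T x \<le> T y" if "x \<le> y" for x y
    using pos[of "y - x"] that by (simp add: linear_diff[OF lin])
  show "\<bar>T x\<bar> \<le> T \<bar>x\<bar>"
    using mono[of x "\<bar>x\<bar>"] mono[of "- x" "\<bar>x\<bar>"] linear_neg[OF lin, of x]
    by (intro abs_leI) (auto simp: abs_ge_self abs_ge_minus_self)
qed

text \<open>Otherwise there are positive \<open>t n\<close> of norm \<open>(1/2) ^ n\<close> whose
  images have norm at least \<open>2 ^ n\<close>. Their sum dominates each \<open>t n\<close>, so
  its image would have norm at least \<open>2 ^ n\<close> for every \<open>n\<close>.\<close>

lemma positive_operator_bounded: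
  fixes T :: "'a::banach_lattice \<Rightarrow> 'b::banach_lattice"
  assumes T: "positive_operator T"
  shows "bounded_linear T"
proof -
  note pT = positive_operatorD[OF T]
  have "\<exists>K. \<forall>x\<ge>0. norm (T x) \<le> norm x * K"
  proof (rule ccontr)
    assume "\<not> ?thesis"
    then have "\<exists>x\<ge>0. norm x * 4 ^ n < norm (T x)" for n :: nat
      by (metis not_le)
    then obtain x where x: "\<And>n. 0 \<le> x n" "\<And>n::nat. norm (x n) * 4 ^ n < norm (T (x n))"
      by metis
    have nz: "0 < norm (x n)" for n
      using x(2)[of n] linear_0[OF pT(1)] by (cases "x n = 0") auto
    define t where "t n = ((1/2) ^ n / norm (x n)) *\<^sub>R x n" for n
    have t0: "0 \<le> t n" for n using x(1) by (simp add: t_def scaleR_nonneg_nonneg)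
    have nt: "norm (t n) = (1/2) ^ n" for n using nz[of n] by (simp add: t_def)
    have "summable t"
      by (rule summable_norm_cancel) (simp add: nt)
    have "2 ^ n \<le> norm (T (suminf t))" for n
    proof -
      have "2 ^ n = ((1/2) ^ n / norm (x n)) * (norm (x n) * 4 ^ n)"
        using nz[of n] by (simp flip: power_mult_distrib)
      also have "\<dots> \<le> ((1/2) ^ n / norm (x n)) * norm (T (x n))"
        using x(2)[of n] by (intro mult_left_mono) auto
      also have "\<dots> = norm (T (t n))"
        by (simp add: t_def linear_scale[OF pT(1)])
      also have "\<dots> \<le> norm (T (suminf t))"
        using t0 \<open>summable t\<close> by (intro norm_mono_bl pT le_suminf_bl) auto
      finally show ?thesis .
    qed
    moreover obtain n where "norm (T (suminf t)) < 2 ^ n"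
      using real_arch_pow[of 2] by auto
    ultimately show False by (meson not_le)
  qed
  then obtain K where K: "\<And>x. 0 \<le> x \<Longrightarrow> norm (T x) \<le> norm x * K" by blast
  show ?thesis
  proof (rule bounded_linear_intro[where K = K])
    fix x show "norm (T x) \<le> norm x * K"
      using norm_mono_abs[of "T x" "T \<bar>x\<bar>"] pT(4)[of x] K[of "\<bar>x\<bar>"]
      by (simp add: abs_of_nonneg pT(2))
  qed (simp_all add: linear_add[OF pT(1)] linear_scale[OF pT(1)])
qed

text \<open>If no \<open>u\<close> worked, splitting would give excesses of norm above
  \<open>\<epsilon>\<close>, dominated by \<open>w k + e k\<close>. The disjoint \<open>w\<close>
  lies in the solid hull of \<open>A\<close> and is therefore norm null, as is
  \<open>e\<close>.\<close>

lemma L_weakly_compact_set_almost_order_bounded: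
  fixes z :: "nat \<Rightarrow> 'a::banach_lattice"
  assumes A: "L_weakly_compact_set A" and z: "\<And>n. z n \<in> A" "\<And>n. 0 \<le> z n" and e: "0 < \<epsilon>"
  shows "\<exists>u\<ge>0. \<forall>\<^sub>F n in sequentially. norm (pprt (z n - u)) \<le> \<epsilon>"
proof (rule ccontr)
  assume "\<not> ?thesis"
  then have fr: "\<exists>\<^sub>F n in sequentially. \<epsilon> < norm (pprt (z n - u))" if "0 \<le> u" for u
    using that by (auto simp: frequently_def not_less)
  have bz: "bounded (range z)"
    using A z(1) by (auto simp: L_weakly_compact_set_def intro: bounded_subset)
  obtain \<nu> w v e where *: "strict_mono \<nu>" "disjoint_seq w" "\<And>k. 0 \<le> w k" "\<And>k. w k \<le> z (\<nu> k)"
    "\<And>k. 0 \<le> v k" "\<And>k. \<epsilon> < norm (pprt (z (\<nu> k) - v k))" "\<And>k. 0 \<le> e k"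
    "\<And>k. z (\<nu> k) \<le> v k + w k + e k" "e \<longlonglongrightarrow> 0"
    by (rule disjoint_splitting[OF z(2) bz, where Q = "\<lambda>u n. \<epsilon> < norm (pprt (z n - u))"])
      (erule fr, blast)
  have "range w \<subseteq> solid hull A"
    using *(3,4) z by (auto simp: mem_solid_hull intro!: bexI[of _ "z (\<nu> _)"])
  then have "w \<longlonglongrightarrow> 0"
    using A *(2) by (simp add: L_weakly_compact_set_def)
  then have "(\<lambda>k. norm (w k + e k)) \<longlonglongrightarrow> 0"
    using *(9) by (intro tendsto_norm_zero tendsto_add_zero)
  then have "\<forall>\<^sub>F k in sequentially. norm (w k + e k) < \<epsilon>"
    using e by (rule order_tendstoD)
  then obtain k where k: "norm (w k + e k) < \<epsilon>"
    by (auto simp: eventually_sequentially)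
  have "pprt (z (\<nu> k) - v k) \<le> w k + e k"
    using *(3,7,8)[of k] by (intro pprt_leI) (simp_all add: algebra_simps)
  then have "norm (pprt (z (\<nu> k) - v k)) \<le> norm (w k + e k)"
    by (intro norm_mono_bl) auto
  with k *(6)[of k] show False by simp
qed

section \<open>Positive bilinear pairings\<close>

text \<open>One setting for both parts of the theorem: \<open>'g\<close> is the space in which the
  operator takes its values, \<open>'h\<close> the space of the test sequence. It is instantiated by
  \<open>dual_apply\<close> and by its flip.\<close>

locale lattice_pairing = bounded_bilinear B
  for B :: "'h::banach_lattice \<Rightarrow> 'g::banach_lattice \<Rightarrow> real" +
  assumes nonneg: "0 \<le> h \<Longrightarrow> 0 \<le> g \<Longrightarrow> 0 \<le> B h g"
begin

lemma mono_left: "h \<le> h' \<Longrightarrow> 0 \<le> g \<Longrightarrow> B h g \<le> B h' g"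
  using nonneg[of "h' - h" g] by (simp add: diff_left)

lemma mono_right: "0 \<le> h \<Longrightarrow> g \<le> g' \<Longrightarrow> B h g \<le> B h g'"
  using nonneg[of h "g' - g"] by (simp add: diff_right)

lemma abs_le: "\<bar>B h g\<bar> \<le> B \<bar>h\<bar> \<bar>g\<bar>"
proof -
  have "B h g = B (pprt h - pprt (- h)) (pprt g - pprt (- g))" by (simp only: pprt_diff)
  then have 1: "B h g = B (pprt h) (pprt g) - B (pprt h) (pprt (- g))
      - B (pprt (- h)) (pprt g) + B (pprt (- h)) (pprt (- g))"
    by (simp add: diff_left diff_right)
  have "B \<bar>h\<bar> \<bar>g\<bar> = B (pprt h + pprt (- h)) (pprt g + pprt (- g))"
    by (simp add: abs_prts pprt_neg)
  then have 2: "B \<bar>h\<bar> \<bar>g\<bar> = B (pprt h) (pprt g) + B (pprt h) (pprt (- g))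
      + B (pprt (- h)) (pprt g) + B (pprt (- h)) (pprt (- g))"
    by (simp add: add_left add_right)
  have "0 \<le> B (pprt h) (pprt g)" "0 \<le> B (pprt h) (pprt (- g))"
    "0 \<le> B (pprt (- h)) (pprt g)" "0 \<le> B (pprt (- h)) (pprt (- g))"
    by (intro nonneg zero_le_pprt)+
  with 1 2 show ?thesis by linarith
qed

lemma bound_of_bounded:
  fixes h :: "nat \<Rightarrow> 'h"
  assumes "bounded (range h)"
  obtains C where "0 < C" "\<And>n g. \<bar>B (h n) g\<bar> \<le> C * norm g"
proof -
  obtain K where K: "0 < K" "\<And>a b. norm (B a b) \<le> norm a * norm b * K" using pos_bounded by auto
  obtain M where M: "0 < M" "\<And>n. norm (h n) \<le> M" using assms by (auto simp: bounded_pos)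
  have "\<bar>B (h n) g\<bar> \<le> (M * K) * norm g" for n g
  proof -
    have "\<bar>B (h n) g\<bar> \<le> norm (h n) * norm g * K" using K(2) by simp
    also have "\<dots> \<le> M * norm g * K" using M K by (intro mult_right_mono) auto
    finally show ?thesis by (simp add: algebra_simps)
  qed
  with M K that[of "M * K"] show thesis by simp
qed

text \<open>Up to small norm the \<open>z n\<close> lie below one element \<open>u\<close>. On the
  part below \<open>u\<close> the assumption \<open>null\<close> applies, on the excess the uniform
  bound for \<open>h\<close>.\<close>

lemma null_on_L_weakly_compact:
  assumes A: "L_weakly_compact_set A" and z: "\<And>n. z n \<in> A" "\<And>n. 0 \<le> z n"
    and h: "\<And>n. 0 \<le> h n" "bounded (range h)" and null: "\<And>u. 0 \<le> u \<Longrightarrow> (\<lambda>n. B (h n) u) \<longlonglongrightarrow> 0"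
  shows "(\<lambda>n. B (h n) (z n)) \<longlonglongrightarrow> 0"
proof (rule LIMSEQ_I)
  fix e :: real assume e: "0 < e"
  obtain C where C: "0 < C" "\<And>n g. \<bar>B (h n) g\<bar> \<le> C * norm g"
    using bound_of_bounded[OF h(2)] by blast
  have "0 < e / (2 * C)" using e C by simp
  then have "\<exists>u\<ge>0. \<forall>\<^sub>F n in sequentially. norm (pprt (z n - u)) \<le> e / (2 * C)"
    by (rule L_weakly_compact_set_almost_order_bounded[OF A z])
  then obtain u where u: "0 \<le> u" and ev: "\<forall>\<^sub>F n in sequentially. norm (pprt (z n - u)) \<le> e / (2 * C)"
    by (elim exE conjE)
  have "\<forall>\<^sub>F n in sequentially. B (h n) u < e / 2"
    using null[OF u] e by (intro order_tendstoD) auto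
  with ev have "\<forall>\<^sub>F n in sequentially. norm (B (h n) (z n) - 0) < e"
  proof eventually_elim
    case (elim n)
    have "B (h n) (z n) = B (h n) (inf (z n) u) + B (h n) (pprt (z n - u))"
      by (subst eq_inf_add_pprt[of "z n" u]) (rule add_right)
    moreover have "B (h n) (inf (z n) u) \<le> B (h n) u" using h(1) by (intro mono_right) auto
    moreover have "B (h n) (pprt (z n - u)) \<le> C * (e / (2 * C))"
      using C(2)[of n "pprt (z n - u)"] mult_left_mono[OF elim(1), of C] C(1) by simp
    moreover have "C * (e / (2 * C)) = e / 2" using C(1) by simp
    ultimately show ?case using elim(2) nonneg[OF h(1) z(2), of n n] by simp
  qed
  then show "\<exists>N. \<forall>n\<ge>N. norm (B (h n) (z n) - 0) < e" by (simp add: eventually_sequentially)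
qed

lemma tendsto_zero_remainder:
  fixes h :: "nat \<Rightarrow> 'h"
  assumes "bounded (range h)" "e \<longlonglongrightarrow> 0"
  shows "(\<lambda>n. B (h (r n)) (e n)) \<longlonglongrightarrow> 0"
proof -
  obtain C where C: "0 < C" "\<And>n g. \<bar>B (h n) g\<bar> \<le> C * norm g"
    using bound_of_bounded[OF assms(1)] by blast
  have "(\<lambda>n. C * norm (e n)) \<longlonglongrightarrow> C * 0"
    by (intro tendsto_mult tendsto_const tendsto_norm_zero assms)
  then show ?thesis
    using C by - (rule Lim_null_comparison[where g = "\<lambda>n. C * norm (e n)", OF always_eventually], auto)
qed

text \<open>By \<open>null\<close>, truncations of \<open>f\<close> at a fixed \<open>v\<close> tend
  to 0 along \<open>z\<close>. If the full pairing frequently stayed above \<open>\<delta>\<close>,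
  splitting would leave more than half of it on \<open>w k + e k\<close>. But \<open>w\<close> is
  bounded and disjoint, so \<open>disj\<close> makes it null along \<open>z\<close>, and
  \<open>e\<close> is norm null.\<close>

lemma null_of_disjoint_null:
  assumes A: "L_weakly_compact_set A" and z: "\<And>n. z n \<in> A" "\<And>n. 0 \<le> z n"
    and f: "\<And>n. 0 \<le> f n" "bounded (range f)"
    and disj: "\<And>h u. \<lbrakk>\<And>n::nat. 0 \<le> h n; disjoint_seq h; bounded (range h); 0 \<le> u\<rbrakk> \<Longrightarrow> (\<lambda>n. B (h n) u) \<longlonglongrightarrow> 0"
    and null: "\<And>v u. \<lbrakk>0 \<le> v; 0 \<le> u\<rbrakk> \<Longrightarrow> (\<lambda>n. B (inf (f n) v) u) \<longlonglongrightarrow> 0"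
  shows "(\<lambda>n. B (f n) (z n)) \<longlonglongrightarrow> 0"
proof (rule ccontr)
  assume "\<not> ?thesis"
  then obtain \<delta> where \<delta>: "0 < \<delta>" "\<exists>\<^sub>F n in sequentially. \<delta> \<le> B (f n) (z n)"
    using nonneg[OF f(1) z(2)] unfolding tendsto_iff frequently_def
    by (auto simp: not_le)
  have bz: "bounded (range z)"
    using A z(1) by (auto simp: L_weakly_compact_set_def intro: bounded_subset)
  have bdd: "bounded (range h)" if "\<And>n. 0 \<le> h n" "\<And>n::nat. h n \<le> f (r n)" for h r
    using f(2) norm_mono_bl[OF that] unfolding bounded_iff by (auto intro: order_trans)
  have fr: "\<exists>\<^sub>F n in sequentially. \<delta> \<le> B (f n) (z n) \<and> B (inf (f n) v) (z n) < \<delta> / 2" if v: "0 \<le> v" for v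
  proof (rule frequently_eventually_frequently[OF \<delta>(2)])
    have "(\<lambda>n. B (inf (f n) v) (z n)) \<longlonglongrightarrow> 0"
      using f(1) v by (intro null_on_L_weakly_compact[OF A z] null bdd[of _ "\<lambda>n. n"]) auto
    then show "\<forall>\<^sub>F n in sequentially. B (inf (f n) v) (z n) < \<delta> / 2"
      using \<delta>(1) by (intro order_tendstoD) auto
  qed
  obtain \<nu> w v e where *: "strict_mono \<nu>" "disjoint_seq w" "\<And>k. 0 \<le> w k" "\<And>k. w k \<le> f (\<nu> k)"
    "\<And>k. 0 \<le> v k" "\<And>k. \<delta> \<le> B (f (\<nu> k)) (z (\<nu> k)) \<and> B (inf (f (\<nu> k)) (v k)) (z (\<nu> k)) < \<delta> / 2"
    "\<And>k. 0 \<le> e k" "\<And>k. f (\<nu> k) \<le> v k + w k + e k" "e \<longlonglongrightarrow> 0"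
    by (rule disjoint_splitting[OF f, where Q = "\<lambda>v n. \<delta> \<le> B (f n) (z n) \<and> B (inf (f n) v) (z n) < \<delta> / 2"])
      (erule fr, blast)
  have bw: "bounded (range w)" using *(3,4) by (rule bdd)
  have "(\<lambda>k. B (w k) (z (\<nu> k))) \<longlonglongrightarrow> 0"
    using z by (rule null_on_L_weakly_compact[OF A _ _ *(3) bw disj[OF *(3,2) bw]])
  moreover have "(\<lambda>k. B (e k) (z (\<nu> k))) \<longlonglongrightarrow> 0"
  proof -
    obtain K where K: "0 < K" "\<And>a b. norm (B a b) \<le> norm a * norm b * K" using pos_bounded by auto
    obtain M where M: "0 < M" "\<And>n. norm (z n) \<le> M" using bz by (auto simp: bounded_pos)
    have "norm (B (e k) (z (\<nu> k))) \<le> norm (e k) * (M * K)" for k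
      using K(2)[of "e k" "z (\<nu> k)"] mult_right_mono[OF mult_left_mono[OF M(2)[of "\<nu> k"] norm_ge_zero[of "e k"]], of K] K(1)
      by (simp add: mult.assoc)
    moreover have "(\<lambda>k. norm (e k) * (M * K)) \<longlonglongrightarrow> 0"
      using tendsto_mult[OF tendsto_norm_zero[OF *(9)] tendsto_const[of "M * K"]] by simp
    ultimately show ?thesis
      by - (rule Lim_null_comparison[where g = "\<lambda>k. norm (e k) * (M * K)", OF always_eventually], auto)
  qed
  ultimately have "(\<lambda>k. B (w k) (z (\<nu> k)) + B (e k) (z (\<nu> k))) \<longlonglongrightarrow> 0"
    by (rule tendsto_add_zero)
  then have "\<forall>\<^sub>F k in sequentially. B (w k) (z (\<nu> k)) + B (e k) (z (\<nu> k)) < \<delta> / 2"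
    using \<delta>(1) by (intro order_tendstoD) auto
  then obtain k where k: "B (w k) (z (\<nu> k)) + B (e k) (z (\<nu> k)) < \<delta> / 2"
    by (auto simp: eventually_sequentially)
  have "pprt (f (\<nu> k) - v k) \<le> w k + e k"
    using *(3,7,8)[of k] by (intro pprt_leI) (simp_all add: algebra_simps)
  then have "B (pprt (f (\<nu> k) - v k)) (z (\<nu> k)) \<le> B (w k + e k) (z (\<nu> k))"
    using z(2) by (rule mono_left)
  moreover have "B (f (\<nu> k)) (z (\<nu> k)) = B (inf (f (\<nu> k)) (v k)) (z (\<nu> k)) + B (pprt (f (\<nu> k) - v k)) (z (\<nu> k))"
    by (subst eq_inf_add_pprt[of "f (\<nu> k)" "v k"]) (rule add_left)
  ultimately show False using k *(6)[of k] by (simp add: add_left)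
qed

text \<open>For fixed \<open>v\<close> the pairing of \<open>h n\<close> with \<open>T v\<close>
  tends to 0, so \<open>w\<close> can be split with a \<open>v k\<close> that contributes less than
  \<open>\<delta> / 2\<close>. The error \<open>e\<close> contributes a null sequence since
  \<open>T\<close> is bounded, and the disjoint \<open>x\<close> must carry the rest.\<close>

lemma disjoint_witness:
  fixes T :: "'e::banach_lattice \<Rightarrow> 'g"
  assumes T: "positive_operator T" and w: "\<And>n. 0 \<le> w n" "\<And>n. norm (w n) \<le> 1"
    and h: "\<And>n. 0 \<le> h n" "bounded (range h)" and null: "\<And>u. 0 \<le> u \<Longrightarrow> (\<lambda>n. B (h n) u) \<longlonglongrightarrow> 0"
    and \<delta>: "0 < \<delta>" "\<And>n. \<delta> \<le> B (h n) (T (w n))"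
  obtains x \<nu> where "strict_mono \<nu>" "pos_disjoint_ball_seq x" "\<not> (\<lambda>n. B (h (\<nu> n)) (T (x n))) \<longlonglongrightarrow> 0"
proof -
  note pT = positive_operatorD[OF T]
  have bw: "bounded (range w)" using w(2) by (auto simp: bounded_iff)
  have fr: "\<exists>\<^sub>F n in sequentially. B (h n) (T v) < \<delta> / 2" if v: "0 \<le> v" for v
    using order_tendstoD(2)[OF null[OF pT(2)[OF v]], of "\<delta> / 2"] \<delta>(1)
    by (auto intro: eventually_frequently)
  obtain \<nu> x v e where *: "strict_mono \<nu>" "disjoint_seq x" "\<And>k. 0 \<le> x k" "\<And>k. x k \<le> w (\<nu> k)"
    "\<And>k. 0 \<le> v k" "\<And>k. B (h (\<nu> k)) (T (v k)) < \<delta> / 2"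
    "\<And>k. 0 \<le> e k" "\<And>k. w (\<nu> k) \<le> v k + x k + e k" "e \<longlonglongrightarrow> 0"
    by (rule disjoint_splitting[OF w(1) bw, where Q = "\<lambda>v n. B (h n) (T v) < \<delta> / 2"])
      (erule fr, blast)
  have "pos_disjoint_ball_seq x"
    using *(2,3) order_trans[OF norm_mono_bl[OF *(3,4)] w(2)]
    by (auto simp: pos_disjoint_ball_seq_def)
  moreover have "\<not> (\<lambda>n. B (h (\<nu> n)) (T (x n))) \<longlonglongrightarrow> 0"
  proof
    assume "(\<lambda>n. B (h (\<nu> n)) (T (x n))) \<longlonglongrightarrow> 0"
    moreover have "(\<lambda>n. B (h (\<nu> n)) (T (e n))) \<longlonglongrightarrow> 0"
      using bounded_linear.tendsto_zero[OF positive_operator_bounded[OF T] *(9)]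
      by (rule tendsto_zero_remainder[OF h(2)])
    ultimately have "(\<lambda>n. B (h (\<nu> n)) (T (x n)) + B (h (\<nu> n)) (T (e n))) \<longlonglongrightarrow> 0"
      by (rule tendsto_add_zero)
    then have "\<forall>\<^sub>F n in sequentially. B (h (\<nu> n)) (T (x n)) + B (h (\<nu> n)) (T (e n)) < \<delta> / 2"
      using \<delta>(1) by (intro order_tendstoD) auto
    then obtain k where k: "B (h (\<nu> k)) (T (x k)) + B (h (\<nu> k)) (T (e k)) < \<delta> / 2"
      by (auto simp: eventually_sequentially)
    have "B (h (\<nu> k)) (T (w (\<nu> k))) \<le> B (h (\<nu> k)) (T (v k + x k + e k))"
      using *(8) h(1) by (intro mono_right pT(3)) auto
    then show False
      using k *(6)[of k] \<delta>(2)[of "\<nu> k"] by (simp add: linear_add[OF pT(1)] add_right)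
  qed
  ultimately show thesis using that *(1) by blast
qed

end

section \<open>Functionals on Banach lattices\<close>

lemma dual_le_apply: "f \<le> g \<Longrightarrow> 0 \<le> x \<Longrightarrow> dual_apply f x \<le> dual_apply g x"
  by (simp add: less_eq_dual_def)

lemma dual_nonneg_apply: "0 \<le> f \<Longrightarrow> 0 \<le> x \<Longrightarrow> 0 \<le> dual_apply f x"
  by (simp add: less_eq_dual_def dual_apply_zero)

lemma bounded_bilinear_dual_apply: "bounded_bilinear dual_apply"
proof
  show "\<exists>K. \<forall>a b. norm (dual_apply a b) \<le> norm a * norm b * K"
    using abs_dual_apply_le by (intro exI[of _ 1]) auto
qed (simp_all add: dual_apply_simps linear_add[OF linear_dual_apply] linear_scale[OF linear_dual_apply])

interpretation dual: lattice_pairing dual_apply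
  by (rule lattice_pairing.intro[OF bounded_bilinear_dual_apply])
    (simp add: lattice_pairing_axioms_def dual_nonneg_apply)

interpretation predual: lattice_pairing "\<lambda>x f. dual_apply f x"
  by (rule lattice_pairing.intro[OF bounded_bilinear.flip[OF bounded_bilinear_dual_apply]])
    (simp add: lattice_pairing_axioms_def dual_nonneg_apply)

text \<open>Every element is a difference of positive ones, and additivity makes the difference of
  the values independent of the decomposition. This turns suprema and infima formed pointwise on the
  cone into functionals.\<close>

lemma dual_of_additive_on_cone:
  fixes h :: "'a::banach_lattice \<Rightarrow> real"
  assumes add: "\<And>x z. 0 \<le> x \<Longrightarrow> 0 \<le> z \<Longrightarrow> h (x + z) = h x + h z"
    and scale: "\<And>c x. 0 \<le> c \<Longrightarrow> 0 \<le> x \<Longrightarrow> h (c *\<^sub>R x) = c * h x"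
    and bound: "\<And>x. 0 \<le> x \<Longrightarrow> \<bar>h x\<bar> \<le> K * norm x"
  shows "\<exists>g. \<forall>x\<ge>0. dual_apply g x = h x"
proof -
  have diff: "h (pprt x) - h (pprt (- x)) = h u - h v" if "x = u - v" "0 \<le> u" "0 \<le> v" for x u v
  proof -
    have "pprt x - pprt (- x) = u - v" by (simp only: pprt_diff that(1))
    moreover have "pprt x + v = (pprt x - pprt (- x)) + v + pprt (- x)" by (simp add: algebra_simps)
    ultimately have "pprt x + v = u + pprt (- x)" by (simp only: diff_add_cancel)
    then have "h (pprt x + v) = h (u + pprt (- x))" by simp
    then show ?thesis using that by (simp add: add)
  qed
  define H where "H x = h (pprt x) - h (pprt (- x))" for x
  have Hs: "H (c *\<^sub>R x) = c * H x" if "0 \<le> c" for c x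
  proof -
    have "c *\<^sub>R x = c *\<^sub>R pprt x - c *\<^sub>R pprt (- x)"
      by (metis pprt_diff scaleR_right_diff_distrib)
    from diff[OF this] that show ?thesis
      by (simp add: H_def scale scaleR_nonneg_nonneg algebra_simps)
  qed
  have "bounded_linear H"
  proof (rule bounded_linear_intro[where K = "2 * \<bar>K\<bar>"])
    fix x z :: 'a and c :: real
    have "x + z = (pprt x + pprt z) - (pprt (- x) + pprt (- z))"
      using pprt_diff[of x] pprt_diff[of z] by (metis add_diff_add)
    from diff[OF this] show "H (x + z) = H x + H z"
      by (simp add: H_def add)
    show "H (c *\<^sub>R x) = c *\<^sub>R H x"
    proof (cases "0 \<le> c")
      case False
      then have "H ((- c) *\<^sub>R (- x)) = (- c) * H (- x)" by (intro Hs) simp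
      then show ?thesis by (simp add: H_def algebra_simps)
    qed (simp add: Hs)
    have "\<bar>h (pprt y)\<bar> \<le> \<bar>K\<bar> * norm x" if "y = x \<or> y = - x" for y
    proof -
      have "\<bar>h (pprt y)\<bar> \<le> K * norm (pprt y)" by (rule bound) simp
      also have "\<dots> \<le> \<bar>K\<bar> * norm (pprt y)" by (intro mult_right_mono) auto
      also have "\<dots> \<le> \<bar>K\<bar> * norm x"
        using norm_pprt_le[of y] that by (intro mult_left_mono) auto
      finally show ?thesis .
    qed
    from this[of x] this[of "- x"] show "norm (H x) \<le> norm x * (2 * \<bar>K\<bar>)"
      by (simp add: H_def algebra_simps)
  qed
  then have "dual_apply (Dual (Blinfun H)) = H" by (rule dual_of_bounded_linear)
  moreover have "h 0 = 0" using add[of 0 0] by simp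
  ultimately show ?thesis
    by (intro exI[of _ "Dual (Blinfun H)"]) (simp add: H_def)
qed

section \<open>Pointwise limits and cluster points of functionals\<close>

lemma dual_pointwise_limit:
  fixes f :: "'i \<Rightarrow> 'a::real_normed_vector dual"
  assumes F: "F \<noteq> bot" and lim: "\<And>x. ((\<lambda>i. dual_apply (f i) x) \<longlongrightarrow> l x) F"
    and M: "\<And>i. norm (f i) \<le> M"
  shows "\<exists>g. dual_apply g = l"
proof -
  have "bounded_linear l"
  proof (rule bounded_linear_intro[where K = M])
    fix x y :: 'a and c :: real
    show "l (x + y) = l x + l y"
      using tendsto_add[OF lim[of x] lim[of y]] lim[of "x + y"] F
      by (intro tendsto_unique[OF F]) (auto simp: linear_add[OF linear_dual_apply])
    show "l (c *\<^sub>R x) = c *\<^sub>R l x"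
      using tendsto_mult_left[OF lim[of x], of c] lim[of "c *\<^sub>R x"]
      by (intro tendsto_unique[OF F]) (auto simp: linear_scale[OF linear_dual_apply])
    show "norm (l x) \<le> norm x * M"
    proof (rule tendsto_upperbound[OF tendsto_norm[OF lim[of x]] _ F])
      have "norm (dual_apply (f i) x) \<le> norm x * M" for i
        using abs_dual_apply_le[of "f i" x] mult_right_mono[OF M[of i] norm_ge_zero[of x]]
        by (simp add: mult.commute)
      then show "\<forall>\<^sub>F i in F. norm (dual_apply (f i) x) \<le> norm x * M" by simp
    qed
  qed
  then show ?thesis using dual_of_bounded_linear by blast
qed

text \<open>This is the Banach-Alaoglu theorem: the functionals lie in a product of compact
  intervals. The filter \<open>H\<close> takes the place of a subnet, since a bounded sequence of
  functionals need not have a pointwise convergent subsequence.\<close>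

lemma dual_bounded_cluster_point:
  fixes f :: "nat \<Rightarrow> 'a::real_normed_vector dual"
  assumes "bounded (range f)"
  obtains H g where "H \<noteq> bot" "H \<le> sequentially"
    "\<And>x. ((\<lambda>n. dual_apply (f n) x) \<longlongrightarrow> dual_apply g x) H"
proof -
  obtain M where M: "\<And>n. norm (f n) \<le> M" using assms by (auto simp: bounded_iff)
  define I where "I x = {- (M * norm x)..M * norm x}" for x :: 'a
  have "compactin (product_topology (\<lambda>_::'a. euclideanreal) UNIV) (PiE UNIV I)"
    by (simp add: compactin_PiE I_def)
  then have comp: "compact (PiE UNIV I)"
    by (simp add: euclidean_product_topology)
  define \<Phi> where "\<Phi> n = dual_apply (f n)" for n
  have "\<Phi> n \<in> PiE UNIV I" for n
  proof -
    have "\<bar>dual_apply (f n) x\<bar> \<le> M * norm x" for x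
      using abs_dual_apply_le[of "f n" x] mult_right_mono[OF M[of n] norm_ge_zero[of x]] by simp
    then show ?thesis by (auto simp: \<Phi>_def I_def abs_le_iff minus_le_iff)
  qed
  then have "\<forall>\<^sub>F y in filtermap \<Phi> sequentially. y \<in> PiE UNIV I"
    by (simp add: eventually_filtermap)
  moreover have "filtermap \<Phi> sequentially \<noteq> bot" by (simp add: filtermap_bot_iff)
  ultimately obtain \<phi> where \<phi>: "inf (nhds \<phi>) (filtermap \<Phi> sequentially) \<noteq> bot"
    using comp[unfolded compact_filter] by blast
  \<comment> \<open>Generated by the tails of the sequence and the sets of indices at which
    \<open>\<Phi>\<close> is near \<open>\<phi>\<close>; it is proper because \<open>\<phi>\<close>
    is a cluster point.\<close>
  define H where "H = inf sequentially (filtercomap \<Phi> (nhds \<phi>))"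
  have "H \<noteq> bot"
  proof
    assume "H = bot"
    then have "eventually (\<lambda>_. False) H" by simp
    then obtain P Q where PQ: "eventually P sequentially" "eventually Q (nhds \<phi>)"
      "\<And>n. P n \<Longrightarrow> Q (\<Phi> n) \<Longrightarrow> False"
      unfolding H_def eventually_inf eventually_filtercomap by blast
    have "eventually (\<lambda>y. \<not> Q y) (filtermap \<Phi> sequentially)"
      unfolding eventually_filtermap using PQ(1) by eventually_elim (use PQ(3) in blast)
    with PQ(2) have "eventually (\<lambda>_. False) (inf (nhds \<phi>) (filtermap \<Phi> sequentially))"
      unfolding eventually_inf by blast
    with \<phi> show False by simp
  qed
  have "filterlim \<Phi> (nhds \<phi>) H"
    unfolding H_def by (rule filterlim_mono[OF filterlim_filtercomap order_refl]) simp
  then have lim: "((\<lambda>n. dual_apply (f n) x) \<longlongrightarrow> \<phi> x) H" for x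
    using continuous_on_tendsto_compose[OF continuous_on_product_coordinates[of x], of \<Phi> \<phi> H]
    by (simp add: \<Phi>_def)
  obtain g where "dual_apply g = \<phi>"
    using dual_pointwise_limit[OF \<open>H \<noteq> bot\<close> lim M] by blast
  with lim \<open>H \<noteq> bot\<close> show thesis
    by (intro that[of H g]) (auto simp: H_def)
qed

section \<open>Infima and carriers of functionals\<close>

text \<open>The Riesz-Kantorovich formula for the infimum. When the infimum vanishes at
  \<open>x\<close>, it cuts \<open>x\<close> into a part \<open>a\<close> on which \<open>g\<close>
  is small and a part \<open>x - a\<close> on which \<open>f\<close> is small.\<close>

lemma dual_inf_approx:
  fixes f g :: "'a::banach_lattice dual"
  assumes "0 \<le> x" "0 < \<epsilon>"
  obtains a where "0 \<le> a" "a \<le> x" "dual_apply f (x - a) + dual_apply g a < dual_apply (inf f g) x + \<epsilon>"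
proof -
  have "dual_apply (inf f g) x = dual_apply f x - rk (f - g) x"
    using assms(1) by (simp add: inf_dual_def sup_dual_def dual_apply_simps dual_pprt_apply)
  moreover have "\<exists>a. 0 \<le> a \<and> a \<le> x \<and> rk (f - g) x - \<epsilon> < dual_apply (f - g) a"
  proof (rule ccontr)
    assume "\<not> ?thesis"
    then have "rk (f - g) x \<le> rk (f - g) x - \<epsilon>" by (intro rk_least assms) (force simp: not_less)
    with assms(2) show False by simp
  qed
  ultimately show thesis
    using that by (auto simp: dual_apply_simps linear_diff[OF linear_dual_apply])
qed

text \<open>The component of \<open>f\<close> in the band of functionals carried by the band that \<open>z\<close> generates.\<close>

definition carrier_part :: "'a::banach_lattice dual \<Rightarrow> 'a \<Rightarrow> 'a dual"
  where "carrier_part f z = (SOME g. \<forall>x\<ge>0. dual_apply g x = (SUP t\<in>{0..}. dual_apply f (inf x (t *\<^sub>R z))))"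

context
  fixes f :: "'a::banach_lattice dual" and z :: 'a
  assumes f: "0 \<le> f" and z: "0 \<le> z"
begin

lemma carrier_part_upper_aux:
  assumes "0 \<le> x" "0 \<le> t"
  shows "dual_apply f (inf x (t *\<^sub>R z)) \<le> (SUP t\<in>{0..}. dual_apply f (inf x (t *\<^sub>R z)))"
  using assms f by (intro cSUP_upper bdd_aboveI2[of _ _ "dual_apply f x"]) (auto intro: dual.mono_right)

text \<open>The supremum is additive on the cone, so the choice in the definition succeeds:
  \<open>inf_add_le\<close> gives one inequality, and adding the two factors of \<open>z\<close>
  gives the other.\<close>

lemma carrier_part_apply:
  assumes "0 \<le> x"
  shows "dual_apply (carrier_part f z) x = (SUP t\<in>{0..}. dual_apply f (inf x (t *\<^sub>R z)))"
proof -
  let ?c = "\<lambda>x. SUP t\<in>{0..}. dual_apply f (inf x (t *\<^sub>R z))"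
  note lin = linear_dual_apply[of f]
  note upper = carrier_part_upper_aux
  have least: "?c x \<le> m" if "\<And>t. 0 \<le> t \<Longrightarrow> dual_apply f (inf x (t *\<^sub>R z)) \<le> m" for x m
    by (rule cSUP_least) (use that in auto)
  have tz: "0 \<le> t *\<^sub>R z" if "0 \<le> t" for t using that z by (rule scaleR_nonneg_nonneg)
  have nn: "0 \<le> ?c x" if "0 \<le> x" for x
    using upper[OF that, of 0] that by (simp add: inf_absorb2 linear_0[OF lin])
  have scale_le: "?c (c *\<^sub>R x) \<le> c * ?c x" if c: "0 < c" and x: "0 \<le> x" for c x
  proof (rule least)
    fix t :: real assume t: "0 \<le> t"
    have "inf (c *\<^sub>R x) (t *\<^sub>R z) = c *\<^sub>R inf x ((t / c) *\<^sub>R z)"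
      using c by (simp add: scaleR_inf_distrib)
    then show "dual_apply f (inf (c *\<^sub>R x) (t *\<^sub>R z)) \<le> c * ?c x"
      using upper[OF x, of "t / c"] t c by (simp add: linear_scale[OF lin])
  qed
  have "\<exists>g. \<forall>x\<ge>0. dual_apply g x = ?c x"
  proof (rule dual_of_additive_on_cone[where K = "norm f"])
    fix x y :: 'a assume x: "0 \<le> x" and y: "0 \<le> y"
    show "?c (x + y) = ?c x + ?c y"
    proof (rule antisym)
      show "?c (x + y) \<le> ?c x + ?c y"
      proof (rule least)
        fix t :: real assume t: "0 \<le> t"
        have "dual_apply f (inf (x + y) (t *\<^sub>R z)) \<le> dual_apply f (inf x (t *\<^sub>R z) + inf y (t *\<^sub>R z))"
          using inf_add_le[OF tz[OF t] x y] f by (intro dual.mono_right) (simp_all add: inf_commute)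
        then show "dual_apply f (inf (x + y) (t *\<^sub>R z)) \<le> ?c x + ?c y"
          using upper[OF x t] upper[OF y t] by (simp add: linear_add[OF lin])
      qed
      have key: "dual_apply f (inf x (t *\<^sub>R z)) + dual_apply f (inf y (s *\<^sub>R z)) \<le> ?c (x + y)"
        if "0 \<le> t" "0 \<le> s" for t s
      proof -
        have "inf x (t *\<^sub>R z) + inf y (s *\<^sub>R z) \<le> inf (x + y) ((t + s) *\<^sub>R z)"
          by (simp add: scaleR_add_left add_mono)
        then have "dual_apply f (inf x (t *\<^sub>R z) + inf y (s *\<^sub>R z)) \<le> dual_apply f (inf (x + y) ((t + s) *\<^sub>R z))"
          using f by (intro dual.mono_right)
        also have "\<dots> \<le> ?c (x + y)" using x y that by (intro upper) auto
        finally show ?thesis by (simp add: linear_add[OF lin])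
      qed
      have "?c x \<le> ?c (x + y) - dual_apply f (inf y (s *\<^sub>R z))" if "0 \<le> s" for s
        by (rule least) (use key that in \<open>auto simp: algebra_simps\<close>)
      then have "?c y \<le> ?c (x + y) - ?c x"
        by (intro least) (auto simp: algebra_simps)
      then show "?c x + ?c y \<le> ?c (x + y)" by simp
    qed
  next
    fix c :: real and x :: 'a assume c: "0 \<le> c" and x: "0 \<le> x"
    show "?c (c *\<^sub>R x) = c * ?c x"
    proof (cases "c = 0")
      case True
      have "?c 0 \<le> 0" by (rule least) (simp add: inf_absorb1 tz linear_0[OF lin])
      with nn[of 0] True show ?thesis by simp
    next
      case False
      with c have c: "0 < c" by simp
      have "?c (inverse c *\<^sub>R c *\<^sub>R x) \<le> inverse c * ?c (c *\<^sub>R x)"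
        using c x by (intro scale_le) (auto intro: scaleR_nonneg_nonneg)
      then have "c * ?c x \<le> ?c (c *\<^sub>R x)" using c by (simp add: field_simps)
      with scale_le[OF c x] show ?thesis by simp
    qed
  next
    fix x :: 'a assume x: "0 \<le> x"
    have "?c x \<le> dual_apply f x"
      by (rule least) (use f in \<open>auto intro: dual.mono_right\<close>)
    then show "\<bar>?c x\<bar> \<le> norm f * norm x"
      using nn[OF x] abs_dual_apply_le[of f x] by simp
  qed
  from someI_ex[OF this] show ?thesis
    using assms unfolding carrier_part_def by blast
qed

lemma carrier_part_upper:
  "0 \<le> x \<Longrightarrow> 0 \<le> t \<Longrightarrow> dual_apply f (inf x (t *\<^sub>R z)) \<le> dual_apply (carrier_part f z) x"
  using carrier_part_upper_aux by (simp add: carrier_part_apply)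

lemma carrier_part_least:
  "0 \<le> x \<Longrightarrow> (\<And>t. 0 \<le> t \<Longrightarrow> dual_apply f (inf x (t *\<^sub>R z)) \<le> m) \<Longrightarrow> dual_apply (carrier_part f z) x \<le> m"
  unfolding carrier_part_apply by (rule cSUP_least) auto

lemma carrier_part_le: "carrier_part f z \<le> f"
  unfolding less_eq_dual_def using f by (auto intro!: carrier_part_least dual.mono_right)

lemma carrier_part_nonneg: "0 \<le> carrier_part f z"
  unfolding less_eq_dual_def
proof (intro allI impI)
  fix x :: 'a assume "0 \<le> x"
  then show "dual_apply 0 x \<le> dual_apply (carrier_part f z) x"
    using carrier_part_upper[of x 0] by (simp add: inf_absorb2 linear_0[OF linear_dual_apply] dual_apply_zero)
qed

lemma carrier_part_self: "dual_apply (carrier_part f z) z = dual_apply f z"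
  using carrier_part_upper[OF z, of 1] dual_le_apply[OF carrier_part_le z] by simp

end

text \<open>Split \<open>x\<close> at \<open>a = inf x (t *\<^sub>R z)\<close>. The second carrier
  part vanishes on \<open>a\<close>, which is disjoint from all multiples of \<open>z'\<close>; so
  the infimum is at most 0 on \<open>a\<close> and at most the first carrier part on
  \<open>x - a\<close>. Taking the supremum over \<open>t\<close> leaves no room for a positive
  value at \<open>x\<close>.\<close>

lemma carrier_part_disjoint:
  assumes f: "0 \<le> f" "0 \<le> f'" and z: "0 \<le> z" "0 \<le> z'" "inf z z' = 0"
  shows "inf (carrier_part f z) (carrier_part f' z') = 0"
proof -
  let ?g = "carrier_part f z" and ?g' = "carrier_part f' z'"
  note g0 = carrier_part_nonneg[OF f(1) z(1)] carrier_part_nonneg[OF f(2) z(2)]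
  have "inf ?g ?g' \<le> 0"
    unfolding less_eq_dual_def
  proof (intro allI impI)
    fix x :: 'a assume x: "0 \<le> x"
    have "dual_apply ?g x \<le> dual_apply ?g x - dual_apply (inf ?g ?g') x"
    proof (rule carrier_part_least[OF f(1) z(1) x])
      fix t :: real assume t: "0 \<le> t"
      define a where "a = inf x (t *\<^sub>R z)"
      have a: "0 \<le> a" "a \<le> x" "a \<le> t *\<^sub>R z" using x t z by (auto simp: a_def scaleR_nonneg_nonneg)
      have "dual_apply ?g' a \<le> 0"
      proof (rule carrier_part_least[OF f(2) z(2) a(1)])
        fix s :: real assume s: "0 \<le> s"
        have "inf (t *\<^sub>R z) (s *\<^sub>R z') = 0"
          using disjoint_scaleR[OF z s] disjoint_scaleR[of "s *\<^sub>R z'" z t] s t z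
          by (simp add: inf_commute scaleR_nonneg_nonneg)
        then have "inf a (s *\<^sub>R z') = 0"
          by (rule disjoint_mono) (use a s z in \<open>auto intro: scaleR_nonneg_nonneg\<close>)
        then show "dual_apply f' (inf a (s *\<^sub>R z')) \<le> 0"
          by (simp add: linear_0[OF linear_dual_apply])
      qed
      moreover have "dual_apply (inf ?g ?g') a \<le> dual_apply ?g' a"
        using a by (intro dual_le_apply) auto
      moreover have "dual_apply (inf ?g ?g') (x - a) \<le> dual_apply ?g (x - a)"
        using a by (intro dual_le_apply) auto
      moreover have "dual_apply f a \<le> dual_apply ?g a"
        using carrier_part_upper[OF f(1) z(1) a(1) t] a(3) by (simp add: inf_absorb1)
      ultimately show "dual_apply f (inf x (t *\<^sub>R z)) \<le> dual_apply ?g x - dual_apply (inf ?g ?g') x"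
        by (simp add: linear_diff[OF linear_dual_apply] flip: a_def)
    qed
    then show "dual_apply (inf ?g ?g') x \<le> dual_apply 0 x" by (simp add: dual_apply_zero)
  qed
  with g0 show ?thesis by (simp add: order_antisym)
qed

section \<open>The Hahn-Banach theorem\<close>

text \<open>A minimal sublinear functional is linear, so the dominated extension theorem of Hahn and
  Banach follows by applying Zorn's lemma to the sublinear functionals themselves.\<close>

definition sublinear :: "('a::real_vector \<Rightarrow> real) \<Rightarrow> bool"
  where "sublinear q \<longleftrightarrow> (\<forall>x y. q (x + y) \<le> q x + q y) \<and> (\<forall>c>0. \<forall>x. q (c *\<^sub>R x) \<le> c * q x)"

lemma sublinearD:
  assumes "sublinear q"
  shows "q (x + y) \<le> q x + q y" "0 < c \<Longrightarrow> q (c *\<^sub>R x) = c * q x" "q 0 = 0" "- q (- x) \<le> q x"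
proof -
  show add: "q (x + y) \<le> q x + q y" for x y using assms by (simp add: sublinear_def)
  have le: "q (c *\<^sub>R x) \<le> c * q x" if "0 < c" for c x using assms that by (simp add: sublinear_def)
  show "q (c *\<^sub>R x) = c * q x" if c: "0 < c"
  proof -
    have "q (inverse c *\<^sub>R c *\<^sub>R x) \<le> inverse c * q (c *\<^sub>R x)" using c by (intro le) auto
    then have "c * q x \<le> q (c *\<^sub>R x)" using c by (simp add: field_simps)
    with le[OF c] show ?thesis by (simp add: order_antisym)
  qed
  show 0: "q 0 = 0" using add[of 0 0] le[of "1/2" 0] by simp
  show "- q (- x) \<le> q x" using add[of x "- x"] 0 by simp
qed

text \<open>The witness is the infimum of \<open>q (x + t *\<^sub>R y) - t * q y\<close> over
  \<open>t \<ge> 0\<close>, bounded below by \<open>- q (- x)\<close>. The value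
  \<open>t = 0\<close> gives \<open>r \<le> q\<close>, and \<open>t = 1\<close> gives the bound at
  \<open>- y\<close>. If \<open>q\<close> is minimal, it follows that
  \<open>q (- y) = - q y\<close>.\<close>

lemma sublinear_shift:
  fixes q :: "'a::real_vector \<Rightarrow> real"
  assumes q: "sublinear q"
  obtains r where "sublinear r" "r \<le> q" "r (- y) \<le> - q y"
proof -
  note s = sublinearD[OF q]
  have ty: "q (t *\<^sub>R y) = t * q y" if "0 \<le> t" for t
    using that s(2)[of t y] s(3) by (cases "t = 0") auto
  define r where "r x = (INF t\<in>{0..}. q (x + t *\<^sub>R y) - t * q y)" for x
  have bdd: "bdd_below ((\<lambda>t. q (x + t *\<^sub>R y) - t * q y) ` {0..})" for x
  proof (rule bdd_belowI2)
    fix t :: real assume "t \<in> {0..}"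
    then show "- q (- x) \<le> q (x + t *\<^sub>R y) - t * q y"
      using s(1)[of "x + t *\<^sub>R y" "- x"] ty[of t] by simp
  qed
  have lower: "r x \<le> q (x + t *\<^sub>R y) - t * q y" if "0 \<le> t" for t x
    unfolding r_def by (rule cINF_lower[OF bdd]) (use that in simp)
  have greatest: "m \<le> r x" if "\<And>t. 0 \<le> t \<Longrightarrow> m \<le> q (x + t *\<^sub>R y) - t * q y" for m x
    unfolding r_def by (rule cINF_greatest) (use that in auto)
  have "sublinear r"
    unfolding sublinear_def
  proof (intro conjI allI impI)
    fix x x'
    have key: "r (x + x') \<le> (q (x + t *\<^sub>R y) - t * q y) + (q (x' + t' *\<^sub>R y) - t' * q y)"
      if "0 \<le> t" "0 \<le> t'" for t t'
      using lower[of "t + t'" "x + x'"] s(1)[of "x + t *\<^sub>R y" "x' + t' *\<^sub>R y"] that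
      by (simp add: algebra_simps)
    have "r (x + x') - (q (x + t *\<^sub>R y) - t * q y) \<le> r x'" if "0 \<le> t" for t
    proof (rule greatest)
      fix t' :: real assume "0 \<le> t'"
      from key[OF that this]
      show "r (x + x') - (q (x + t *\<^sub>R y) - t * q y) \<le> q (x' + t' *\<^sub>R y) - t' * q y" by linarith
    qed
    then have "r (x + x') - r x' \<le> r x" by (intro greatest) (auto simp: algebra_simps)
    then show "r (x + x') \<le> r x + r x'" by simp
  next
    fix c :: real and x assume c: "0 < c"
    have "r (c *\<^sub>R x) / c \<le> r x"
    proof (rule greatest)
      fix t :: real assume t: "0 \<le> t"
      have "r (c *\<^sub>R x) \<le> q (c *\<^sub>R x + (c * t) *\<^sub>R y) - (c * t) * q y"
        using c t by (intro lower) auto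
      also have "c *\<^sub>R x + (c * t) *\<^sub>R y = c *\<^sub>R (x + t *\<^sub>R y)" by (simp add: scaleR_add_right)
      also have "q (c *\<^sub>R (x + t *\<^sub>R y)) = c * q (x + t *\<^sub>R y)" using c by (rule s(2))
      finally have "r (c *\<^sub>R x) \<le> c * (q (x + t *\<^sub>R y) - t * q y)"
        by (simp add: algebra_simps)
      then show "r (c *\<^sub>R x) / c \<le> q (x + t *\<^sub>R y) - t * q y"
        using c by (simp add: field_simps)
    qed
    then show "r (c *\<^sub>R x) \<le> c * r x" using c by (simp add: field_simps)
  qed
  moreover have "r \<le> q" using lower[of 0] by (simp add: le_fun_def)
  moreover have "r (- y) \<le> - q y" using lower[of 1 "- y"] s(3) by simp
  ultimately show thesis by (rule that)
qed

text \<open>The common bound \<open>p\<close> keeps the infimum finite, since each member is at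
  least \<open>- p (- x)\<close> at \<open>x\<close>. For subadditivity, two members of the chain
  are replaced by the smaller one.\<close>

lemma sublinear_INF_chain:
  fixes C :: "('a::real_vector \<Rightarrow> real) set"
  assumes C: "C \<noteq> {}" "\<And>q. q \<in> C \<Longrightarrow> sublinear q \<and> q \<le> p"
    and chain: "\<And>q r. q \<in> C \<Longrightarrow> r \<in> C \<Longrightarrow> q \<le> r \<or> r \<le> q"
  shows "sublinear (\<lambda>x. INF q\<in>C. q x)" "q \<in> C \<Longrightarrow> (\<lambda>x. INF q\<in>C. q x) \<le> q"
proof -
  let ?r = "\<lambda>x. INF q\<in>C. q x"
  have bdd: "bdd_below ((\<lambda>q. q x) ` C)" for x
  proof (rule bdd_belowI2)
    fix q assume q: "q \<in> C"
    then have "q (- x) \<le> p (- x)" using C(2) by (simp add: le_fun_def)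
    then show "- p (- x) \<le> q x" using C(2)[OF q] sublinearD(4)[of q x] by simp
  qed
  have lower: "?r x \<le> q x" if "q \<in> C" for q x using that by (intro cINF_lower bdd)
  show "q \<in> C \<Longrightarrow> ?r \<le> q" using lower by (simp add: le_fun_def)
  have greatest: "m \<le> ?r x" if "\<And>q. q \<in> C \<Longrightarrow> m \<le> q x" for m x
    by (rule cINF_greatest[OF C(1)]) (rule that)
  show "sublinear ?r"
    unfolding sublinear_def
  proof (intro conjI allI impI)
    fix x y
    have key: "?r (x + y) \<le> q x + r y" if "q \<in> C" "r \<in> C" for q r
    proof -
      obtain s where "s \<in> C" "s \<le> q" "s \<le> r" using chain[of q r] \<open>q \<in> C\<close> \<open>r \<in> C\<close> by blast
      then have "?r (x + y) \<le> s x + s y"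
        using lower[of s "x + y"] sublinearD(1)[of s x y] C(2) by force
      also have "\<dots> \<le> q x + r y" using \<open>s \<le> q\<close> \<open>s \<le> r\<close> by (simp add: le_fun_def add_mono)
      finally show ?thesis .
    qed
    have "?r (x + y) - q x \<le> ?r y" if "q \<in> C" for q
      by (rule greatest) (use key[OF that] in \<open>simp add: algebra_simps\<close>)
    then have "?r (x + y) - ?r y \<le> ?r x" by (intro greatest) (simp add: algebra_simps)
    then show "?r (x + y) \<le> ?r x + ?r y" by simp
  next
    fix c :: real and x assume c: "0 < c"
    have "?r (c *\<^sub>R x) / c \<le> ?r x"
    proof (rule greatest)
      fix q assume "q \<in> C"
      then show "?r (c *\<^sub>R x) / c \<le> q x"
        using lower[of q "c *\<^sub>R x"] sublinearD(2)[of q c x] C(2) c by (simp add: field_simps)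
    qed
    then show "?r (c *\<^sub>R x) \<le> c * ?r x" using c by (simp add: field_simps)
  qed
qed

lemma hahn_banach_sublinear:
  fixes p :: "'a::real_vector \<Rightarrow> real"
  assumes p: "sublinear p"
  obtains f where "linear f" "\<And>x. f x \<le> p x" "f z = p z"
proof -
  \<comment> \<open>Shifting at \<open>z\<close> before applying Zorn's lemma fixes the value there:
    a linear \<open>f\<close> below \<open>p'\<close> satisfies \<open>f (- z) \<le> - p z\<close>,
    that is \<open>p z \<le> f z\<close>.\<close>
  obtain p' where p': "sublinear p'" "p' \<le> p" "p' (- z) \<le> - p z"
    using sublinear_shift[OF p] by blast
  let ?A = "{q. sublinear q \<and> q \<le> p'}"
  have "\<exists>m\<in>?A. \<forall>a\<in>?A. a \<le> m \<longrightarrow> a = m"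
  proof (rule predicate_Zorn)
    show "partial_order_on ?A (relation_of (\<lambda>a b. b \<le> a) ?A)"
      by (rule partial_order_on_relation_ofI) auto
  next
    fix C assume C: "C \<in> Chains (relation_of (\<lambda>a b. b \<le> a) ?A)"
    then have CA: "C \<subseteq> ?A" and chain: "\<And>q r. q \<in> C \<Longrightarrow> r \<in> C \<Longrightarrow> q \<le> r \<or> r \<le> q"
      unfolding Chains_def relation_of_def by blast+
    show "\<exists>u\<in>?A. \<forall>a\<in>C. u \<le> a"
    proof (cases "C = {}")
      case False
      then obtain q where "q \<in> C" by blast
      have CA': "sublinear q \<and> q \<le> p'" if "q \<in> C" for q using that CA by blast
      note I = sublinear_INF_chain[OF False CA' chain]
      have "(\<lambda>x. INF q\<in>C. q x) \<le> p'"
        using order_trans[OF I(2)[OF _ _ _ \<open>q \<in> C\<close>]] CA'[OF \<open>q \<in> C\<close>] by blast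
      with I show ?thesis by (intro bexI[of _ "\<lambda>x. INF q\<in>C. q x"]) auto
    qed (use p'(1) in auto)
  qed
  then obtain m where m: "sublinear m" "m \<le> p'" and min: "\<And>a. sublinear a \<Longrightarrow> a \<le> m \<Longrightarrow> a = m"
    by (auto intro: order_trans)
  note s = sublinearD[OF m(1)]
  have neg: "m (- y) = - m y" for y
  proof -
    obtain r where "sublinear r" "r \<le> m" "r (- y) \<le> - m y"
      using sublinear_shift[OF m(1)] by blast
    with min have "m (- y) \<le> - m y" by blast
    with s(4)[of y] show ?thesis by simp
  qed
  have "linear m"
  proof (rule linearI)
    fix x y show "m (x + y) = m x + m y"
      using s(1)[of x y] s(1)[of "- x" "- y"] neg[of "x + y"] by (simp add: neg)
  next
    fix c x
    have pos: "m (c *\<^sub>R x) = c * m x" if "0 \<le> c" for c x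
      using s(2)[of c x] s(3) that by (cases "c = 0") auto
    show "m (c *\<^sub>R x) = c *\<^sub>R m x"
    proof (cases "0 \<le> c")
      case False
      then show ?thesis using pos[of "- c" x] neg[of "c *\<^sub>R x"] by simp
    qed (simp add: pos)
  qed
  moreover have le: "m x \<le> p x" for x
    using m(2) p'(2) by (force simp: le_fun_def intro: order_trans)
  moreover have "m z = p z"
    using le[of z] le_funD[OF m(2), of "- z"] p'(3) neg[of z] by simp
  ultimately show thesis by (rule that)
qed

text \<open>Hahn-Banach is applied to the norm of the positive part instead of the norm. This
  vanishes at \<open>- x\<close> for \<open>x \<ge> 0\<close>, which forces the functional to be
  positive.\<close>

lemma positive_norming_functional:
  fixes z :: "'a::banach_lattice"
  assumes z: "0 \<le> z"
  obtains f where "0 \<le> f" "norm f \<le> 1" "dual_apply f z = norm z"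
proof -
  have "sublinear (\<lambda>x::'a. norm (pprt x))"
    unfolding sublinear_def
  proof (intro conjI allI impI)
    fix x y :: 'a
    have "pprt (x + y) \<le> pprt x + pprt y" by (intro pprt_leI add_mono le_pprt add_nonneg_nonneg) auto
    then have "norm (pprt (x + y)) \<le> norm (pprt x + pprt y)" by (intro norm_mono_bl) auto
    then show "norm (pprt (x + y)) \<le> norm (pprt x) + norm (pprt y)"
      using norm_triangle_ineq order_trans by blast
  next
    fix c :: real and x :: 'a assume "0 < c"
    then show "norm (pprt (c *\<^sub>R x)) \<le> c * norm (pprt x)" by (simp flip: scaleR_pprt)
  qed
  from hahn_banach_sublinear[OF this, of z]
  obtain f where f: "linear f" "\<And>x. f x \<le> norm (pprt x)" "f z = norm (pprt z)" by blast
  have b: "norm (f x) \<le> norm x * 1" for x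
    using f(2)[of x] f(2)[of "- x"] norm_pprt_le[of x] norm_pprt_le[of "- x"] linear_neg[OF f(1), of x]
    by (simp add: abs_le_iff)
  have "bounded_linear f"
    by (rule bounded_linear_intro[OF _ _ b]) (simp_all add: linear_add[OF f(1)] linear_scale[OF f(1)])
  then have ap: "dual_apply (Dual (Blinfun f)) = f" by (rule dual_of_bounded_linear)
  show thesis
  proof (rule that[of "Dual (Blinfun f)"])
    show "0 \<le> Dual (Blinfun f)"
      unfolding less_eq_dual_def
    proof (intro allI impI)
      fix x :: 'a assume "0 \<le> x"
      then show "dual_apply 0 x \<le> dual_apply (Dual (Blinfun f)) x"
        using f(2)[of "- x"] linear_neg[OF f(1), of x] by (simp add: ap dual_apply_zero)
    qed
    show "norm (Dual (Blinfun f)) \<le> 1" by (rule norm_dual_le) (use b ap in auto)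
    show "dual_apply (Dual (Blinfun f)) z = norm z" using f(3) z by (simp add: ap)
  qed
qed

section \<open>Disjoint sequences under order continuity\<close>

lemma bounded_subseq: "bounded (range f) \<Longrightarrow> bounded (range (\<lambda>n. f (r n)))"
  by (rule bounded_subset) auto

text \<open>Along a subsequence \<open>g\<close> with values at least \<open>\<delta>\<close> at
  \<open>x\<close>, disjointness gives \<open>a n \<le> x\<close> that carries almost all of
  \<open>g n\<close> while the earlier functionals are tiny on it. The suprema \<open>b m\<close> of
  the tails of \<open>a\<close> decrease and converge in norm, so \<open>g m\<close> is eventually
  small on \<open>b m - b (Suc m)\<close>. Yet \<open>g m\<close> is large on \<open>b m\<close>,
  which dominates \<open>a m\<close>, and small on \<open>b (Suc m)\<close>, which involves only
  later \<open>a i\<close>.\<close>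

lemma oc_dual_disjoint_pointwise_null:
  fixes f :: "nat \<Rightarrow> 'a::banach_lattice dual"
  assumes oc: "order_continuous_norm TYPE('a)"
    and f: "\<And>n. 0 \<le> f n" "disjoint_seq f" "bounded (range f)" and x: "0 \<le> x"
  shows "(\<lambda>n. dual_apply (f n) x) \<longlonglongrightarrow> 0"
proof (rule ccontr)
  assume "\<not> ?thesis"
  then obtain \<delta> where \<delta>: "0 < \<delta>" "\<not> eventually (\<lambda>n. \<bar>dual_apply (f n) x\<bar> < \<delta>) sequentially"
    unfolding tendsto_iff by auto
  obtain r :: "nat \<Rightarrow> nat" where r: "strict_mono r" "\<And>n. \<delta> \<le> \<bar>dual_apply (f (r n)) x\<bar>"
    using not_eventually_sequentiallyD[OF \<delta>(2)] by (auto simp: not_less)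
  define g where "g n = f (r n)" for n
  have g0: "0 \<le> g n" for n by (simp add: g_def f)
  have gx: "\<delta> \<le> dual_apply (g n) x" for n
    using r(2)[of n] dual_nonneg_apply[OF g0[of n] x] by (simp add: g_def)
  have gdisj: "inf (g n) (g m) = 0" if "n \<noteq> m" for n m
    using f(1,2) that strict_mono_eq[OF r(1)] by (simp add: g_def disjoint_seq_nonneg)
  have bg: "bounded (range g)" unfolding g_def using f(3) by (rule bounded_subseq)
  \<comment> \<open>Passing from \<open>x\<close> to \<open>a m\<close> costs one
    \<open>\<eta>\<close> and subtracting \<open>b (Suc m)\<close> another, which leaves
    \<open>2 * \<eta>\<close> against a bound of \<open>\<eta>\<close>.\<close>
  define \<eta> where "\<eta> = \<delta> / 4"
  have \<eta>: "0 < \<eta>" using \<delta> by (simp add: \<eta>_def)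
  have "\<exists>a. 0 \<le> a \<and> a \<le> x \<and> dual_apply (g n) (x - a) + dual_apply (\<Sum>i<n. g i) a < \<eta> * (1/2) ^ n" for n
  proof -
    have "inf (g n) (\<Sum>i<n. g i) = 0" by (rule disjoint_sum) (auto simp: g0 gdisj)
    then show ?thesis
      using dual_inf_approx[OF x, of "\<eta> * (1/2) ^ n" "g n" "\<Sum>i<n. g i"] \<eta>
      by (metis dual_apply_zero add_0 mult_pos_pos zero_less_power half_gt_zero_iff zero_less_one)
  qed
  then obtain a where a: "\<And>n. 0 \<le> a n" "\<And>n. a n \<le> x"
    "\<And>n. dual_apply (g n) (x - a n) + dual_apply (\<Sum>i<n. g i) (a n) < \<eta> * (1/2) ^ n" by metis
  have s0: "0 \<le> (\<Sum>i<n. g i)" for n by (intro sum_nonneg) (simp add: g0)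
  have small: "dual_apply (g m) (a n) \<le> \<eta> * (1/2) ^ n" if "m < n" for m n
  proof -
    have "g m \<le> (\<Sum>i<n. g i)" using that sum_mono2[of "{..<n}" "{m}" g] g0 by auto
    then have "dual_apply (g m) (a n) \<le> dual_apply (\<Sum>i<n. g i) (a n)" using a(1) by (rule dual_le_apply)
    moreover have "0 \<le> dual_apply (g n) (x - a n)" using a(2) g0 by (intro dual_nonneg_apply) auto
    ultimately show ?thesis using a(3)[of n] by linarith
  qed
  have big: "\<delta> - \<eta> \<le> dual_apply (g n) (a n)" for n
  proof -
    have "\<eta> * (1/2) ^ n \<le> \<eta>" using \<eta> by (simp add: power_le_one)
    then show ?thesis
      using a(3)[of n] gx[of n] dual_nonneg_apply[OF s0 a(1), of n n] by (simp add: linear_diff[OF linear_dual_apply])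
  qed
  \<comment> \<open>Suprema of finite stretches of \<open>a\<close>. Infinite suprema need not exist
    a priori; order continuity provides them as the norm limits \<open>b m\<close>.\<close>
  define c where "c m N = Sup_fin (a ` {m..m + N})" for m N
  have c_ge: "a i \<le> c m N" if "m \<le> i" "i \<le> m + N" for i m N
    unfolding c_def using that by (intro Sup_fin.coboundedI) auto
  have c_le: "c m N \<le> b" if "\<And>i. m \<le> i \<Longrightarrow> i \<le> m + N \<Longrightarrow> a i \<le> b" for m N b
    unfolding c_def using that by (intro Sup_fin.boundedI) auto
  define b where "b m = lim (c m)" for m
  have c_lim: "c m \<longlonglongrightarrow> b m" for m
    unfolding b_def convergent_LIMSEQ_iff[symmetric]
  proof (rule oc_increasing_convergent[OF oc, where u = x])
    show "c m N \<le> c m (Suc N)" for N by (rule c_le, rule c_ge) auto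
    show "c m N \<le> x" for N by (rule c_le, rule a)
  qed
  have b_ge: "a m \<le> b m" for m
  proof (rule lim_mono_bl[OF tendsto_const c_lim])
    show "\<forall>\<^sub>F N in sequentially. a m \<le> c m N" by (intro always_eventually allI c_ge) auto
  qed simp
  have b_dec: "b (Suc m) \<le> b m" for m
  proof (rule lim_mono_bl[OF c_lim LIMSEQ_Suc[OF c_lim[of m]]])
    have "c (Suc m) N \<le> c m (Suc N)" for N by (rule c_le, rule c_ge) auto
    then show "\<forall>\<^sub>F N in sequentially. c (Suc m) N \<le> c m (Suc N)" by simp
  qed simp
  have b_small: "dual_apply (g m) (b (Suc m)) \<le> \<eta>" for m
  proof (rule tendsto_upperbound[OF bounded_linear.tendsto[OF bounded_linear_dual_apply c_lim]])
    have "dual_apply (g m) (c (Suc m) N) \<le> \<eta>" for N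
    proof -
      have "c (Suc m) N \<le> (\<Sum>i = Suc m..Suc m + N. a i)"
      proof (rule c_le)
        fix i assume "Suc m \<le> i" "i \<le> Suc m + N"
        then show "a i \<le> (\<Sum>i = Suc m..Suc m + N. a i)"
          using sum_mono2[of "{Suc m..Suc m + N}" "{i}" a] a(1) by auto
      qed
      then have "dual_apply (g m) (c (Suc m) N) \<le> dual_apply (g m) (\<Sum>i = Suc m..Suc m + N. a i)"
        using g0 by (intro dual.mono_right)
      also have "\<dots> = (\<Sum>i = Suc m..Suc m + N. dual_apply (g m) (a i))"
        by (rule linear_sum[OF linear_dual_apply])
      also have "\<dots> \<le> (\<Sum>i = Suc m..Suc m + N. \<eta> * (1/2) ^ i)"
        by (intro sum_mono small) auto
      also have "\<dots> = \<eta> * (\<Sum>i = Suc m..Suc m + N. (1/2) ^ i)" by (rule sum_distrib_left[symmetric])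
      also have "(\<Sum>i = Suc m..Suc m + N. (1/2::real) ^ i) = (1/2) ^ m - (1/2) ^ (Suc m + N)"
        by (induction N) auto
      also have "\<eta> * \<dots> \<le> \<eta> * 1"
      proof -
        have "(1/2::real) ^ m \<le> 1" "0 \<le> (1/2::real) ^ (Suc m + N)" by (simp_all add: power_le_one)
        then show ?thesis using \<eta> by (intro mult_left_mono) linarith+
      qed
      finally show ?thesis by simp
    qed
    then show "\<forall>\<^sub>F N in sequentially. dual_apply (g m) (c (Suc m) N) \<le> \<eta>" by simp
  qed simp
  have "convergent (\<lambda>m. - b m)"
    by (rule oc_increasing_convergent[OF oc, where u = 0])
      (use b_dec order_trans[OF a(1) b_ge] in auto)
  then obtain l where "b \<longlonglongrightarrow> l"
    unfolding convergent_minus_iff[symmetric] by (auto simp: convergent_def)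
  then have "(\<lambda>m. b m - b (Suc m)) \<longlonglongrightarrow> 0"
    using tendsto_diff[OF _ LIMSEQ_Suc] by fastforce
  from dual.tendsto_zero_remainder[OF bg this, of "\<lambda>n. n"]
  have "\<forall>\<^sub>F m in sequentially. dual_apply (g m) (b m - b (Suc m)) < \<eta>"
    using \<eta> by (intro order_tendstoD) auto
  then obtain m where "dual_apply (g m) (b m - b (Suc m)) < \<eta>"
    by (auto simp: eventually_sequentially)
  moreover have "dual_apply (g m) (a m) \<le> dual_apply (g m) (b m)"
    using g0 b_ge by (intro dual.mono_right)
  ultimately show False
    using b_small[of m] big[of m] \<eta> by (simp add: linear_diff[OF linear_dual_apply] \<eta>_def)
qed

text \<open>The carrier parts of \<open>u\<close> on the \<open>g n\<close> are disjoint and below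
  \<open>u\<close>, hence norm null in the dual, and they agree with \<open>u\<close> at
  \<open>g n\<close>.\<close>

lemma oc_dual_disjoint_weakly_null:
  fixes g :: "nat \<Rightarrow> 'a::banach_lattice"
  assumes oc: "order_continuous_norm TYPE('a dual)"
    and g: "\<And>n. 0 \<le> g n" "disjoint_seq g" "bounded (range g)" and u: "0 \<le> u"
  shows "(\<lambda>n. dual_apply u (g n)) \<longlonglongrightarrow> 0"
proof -
  define p where "p n = carrier_part u (g n)" for n
  have p0: "0 \<le> p n" for n using u g by (simp add: p_def carrier_part_nonneg)
  have "disjoint_seq p"
    unfolding disjoint_seq_nonneg[of p, OF p0]
    using g u by (auto simp: p_def disjoint_seq_nonneg intro!: carrier_part_disjoint)
  then have "p \<longlonglongrightarrow> 0"
    by (rule oc_order_bounded_disjoint_null[OF oc p0, where u = u]) (simp add: p_def carrier_part_le u g)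
  from predual.tendsto_zero_remainder[OF g(3) this, of "\<lambda>n. n"]
  show ?thesis using u g by (simp add: p_def carrier_part_self)
qed

section \<open>Disjoint elements on which disjoint functionals stay large\<close>

lemma dual_norming_positive:
  fixes f :: "'a::banach_lattice dual"
  assumes f: "0 \<le> f" and c: "0 \<le> c" "c < norm f"
  obtains y where "0 \<le> y" "norm y \<le> 1" "c \<le> dual_apply f y"
proof -
  obtain x where x: "c * norm x < \<bar>dual_apply f x\<bar>"
    using norm_dual_le[OF c(1), of f] c(2) by (meson not_le)
  then have nx: "0 < norm x"
    by (cases "x = 0") (auto simp: linear_0[OF linear_dual_apply])
  have "\<bar>dual_apply f x\<bar> \<le> dual_apply f \<bar>x\<bar>" using dual.abs_le[of f x] f by (simp add: abs_of_nonneg)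
  with x have "c * norm x \<le> dual_apply f \<bar>x\<bar>" by simp
  then have "c \<le> dual_apply f ((1 / norm x) *\<^sub>R \<bar>x\<bar>)"
    using nx by (simp add: linear_scale[OF linear_dual_apply] field_simps)
  then show thesis using nx by (intro that[of "(1 / norm x) *\<^sub>R \<bar>x\<bar>"]) (auto intro: scaleR_nonneg_nonneg)
qed

text \<open>Here \<open>\<phi>\<close> is a weak* cluster point of the functionals. Since the norm of the dual is order
  continuous, \<open>inf (f n) \<phi>\<close> tends to 0 in norm, so for large \<open>n\<close> the functional \<open>f n\<close> is almost carried
  by some \<open>a n \<le> u\<close> on which \<open>\<phi>\<close>, and hence infinitely many of the later functionals, are small.\<close>

lemma oc_dual_disjoint_witness_order_bounded:
  fixes f :: "nat \<Rightarrow> 'a::banach_lattice dual"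
  assumes oc: "order_continuous_norm TYPE('a dual)"
    and f: "\<And>n. 0 \<le> f n" "disjoint_seq f" "bounded (range f)"
    and u: "0 \<le> u" and \<delta>: "0 < \<delta>" "\<And>n. \<delta> \<le> dual_apply (f n) u"
  obtains \<nu> y where "strict_mono \<nu>" "\<And>n. 0 \<le> y n" "disjoint_seq y" "bounded (range y)"
    "\<And>n. \<delta> / 2 \<le> dual_apply (f (\<nu> n)) (y n)"
proof -
  obtain H \<phi> where H: "H \<noteq> bot" "H \<le> sequentially"
    and \<phi>: "\<And>x. ((\<lambda>n. dual_apply (f n) x) \<longlongrightarrow> dual_apply \<phi> x) H"
    using dual_bounded_cluster_point[OF f(3)] by blast
  have \<phi>0: "0 \<le> \<phi>"
    unfolding less_eq_dual_def
  proof (intro allI impI)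
    fix x :: 'a assume "0 \<le> x"
    then show "dual_apply 0 x \<le> dual_apply \<phi> x"
      unfolding dual_apply_zero
      by (intro tendsto_lowerbound[OF \<phi> _ H(1)] always_eventually allI dual_nonneg_apply f)
  qed
  define p where "p n = inf (f n) \<phi>" for n
  have p0: "0 \<le> p n" for n using f \<phi>0 by (simp add: p_def)
  have "disjoint_seq p"
    by (rule disjoint_seq_dominated[OF f(2)]) (use f \<phi>0 in \<open>simp add: p_def abs_of_nonneg\<close>)
  then have "p \<longlonglongrightarrow> 0"
    by (rule oc_order_bounded_disjoint_null[OF oc p0, where u = \<phi>]) (simp add: p_def)
  define \<epsilon> where "\<epsilon> n = dual_apply (p n) u + inverse (real (Suc n))" for n
  have "(\<lambda>n. dual_apply (p n) u) \<longlonglongrightarrow> 0"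
    using dual.tendsto_left_zero[OF \<open>p \<longlonglongrightarrow> 0\<close>] .
  then have "\<epsilon> \<longlonglongrightarrow> 0"
    unfolding \<epsilon>_def by (rule tendsto_add_zero) (rule LIMSEQ_inverse_real_of_nat)
  have "\<exists>a. 0 \<le> a \<and> a \<le> u \<and> dual_apply (f n) (u - a) + dual_apply \<phi> a < \<epsilon> n" for n
    using dual_inf_approx[OF u, of "inverse (real (Suc n))" "f n" \<phi>]
    unfolding \<epsilon>_def p_def by (metis inverse_positive_iff_positive of_nat_0_less_iff zero_less_Suc)
  then obtain a where a: "\<And>n. 0 \<le> a n" "\<And>n. a n \<le> u"
    "\<And>n. dual_apply (f n) (u - a n) + dual_apply \<phi> (a n) < \<epsilon> n" by metis
  have a1: "dual_apply \<phi> (a n) < \<epsilon> n" "dual_apply (f n) (u - a n) < \<epsilon> n" for n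
    using a(3)[of n] dual_nonneg_apply[OF f(1), of "u - a n" n] dual_nonneg_apply[OF \<phi>0 a(1), of n] a(2)[of n]
    by simp_all
  obtain C where C: "0 < C" "\<And>n x. \<bar>dual_apply (f n) x\<bar> \<le> C * norm x"
    using dual.bound_of_bounded[OF f(3)] by blast
  \<comment> \<open>A fixed factor suffices because all \<open>a n\<close> lie below
    \<open>u\<close>: earlier terms are subtracted with factor \<open>t\<close>, later ones through
    \<open>(1/t) *\<^sub>R u\<close>. The constants keep the losses \<open>\<eta>\<close>,
    \<open>t * \<eta>\<close> and at most \<open>\<delta> / 8\<close> within
    \<open>\<delta> / 4\<close> in total.\<close>
  define t where "t = 1 + 8 * C * norm u / \<delta>"
  have t: "1 \<le> t" "0 < t" using C \<delta> by (simp_all add: t_def add_pos_nonneg)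
  define \<eta> where "\<eta> = \<delta> / (16 * t)"
  have \<eta>: "0 < \<eta>" "\<eta> \<le> \<delta> / 16" "t * \<eta> = \<delta> / 16" using t \<delta> by (simp_all add: \<eta>_def field_simps)
  \<comment> \<open>A state is an index with the sum of the \<open>a\<close> chosen before it. The
    new functional is small on this sum; the bound for \<open>\<phi>\<close> on the enlarged sum
    lets the choice continue, since \<open>f n\<close> tends to \<open>\<phi>\<close> along
    \<open>H\<close>.\<close>
  let ?P = "\<lambda>k (p::nat \<times> 'a). 0 \<le> snd p \<and> dual_apply (f (fst p)) (snd p) < \<eta> \<and>
      dual_apply \<phi> (snd p + a (fst p)) < \<eta> \<and> \<epsilon> (fst p) < \<eta>"
  let ?R = "\<lambda>k (p::nat \<times> 'a) q. fst p < fst q \<and> snd q = snd p + a (fst p)"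
  have pick: "\<exists>n>N. ?P 0 (n, s)" if s: "0 \<le> s" "dual_apply \<phi> s < \<eta>" for s N
  proof -
    have ev: "\<forall>\<^sub>F n in H. P n" if "eventually P sequentially" for P
      using that H(2) by (rule filter_leD[rotated])
    have "\<forall>\<^sub>F n in H. n > N" by (rule ev[OF eventually_gt_at_top])
    moreover have "\<forall>\<^sub>F n in H. dual_apply (f n) s < \<eta>"
      using s(2) by (rule order_tendstoD[OF \<phi>])
    moreover have "\<forall>\<^sub>F n in H. \<epsilon> n < \<eta> - dual_apply \<phi> s"
      by (rule ev[OF order_tendstoD(2)[OF \<open>\<epsilon> \<longlonglongrightarrow> 0\<close>]]) (use s in simp)
    ultimately have "\<forall>\<^sub>F n in H. n > N \<and> ?P 0 (n, s)"
    proof eventually_elim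
      case (elim n)
      then show ?case
        using s(1) a1(1)[of n] dual_nonneg_apply[OF \<phi>0 s(1)] by (simp add: linear_add[OF linear_dual_apply])
    qed
    then show ?thesis using eventually_happens'[OF H(1)] by blast
  qed
  obtain n0 where "?P 0 (n0, 0)"
    using pick[of 0 0] \<eta>(1) by (auto simp: linear_0[OF linear_dual_apply])
  then have "\<exists>p. ?P 0 p" by blast
  moreover have "\<exists>q. ?P (Suc k) q \<and> ?R k p q" if "?P k p" for k p
  proof -
    have "0 \<le> snd p + a (fst p)" using that a(1) by simp
    with pick[of "snd p + a (fst p)" "fst p"] that
    obtain n where "n > fst p" "?P 0 (n, snd p + a (fst p))" by blast
    then show ?thesis by (intro exI[of _ "(n, snd p + a (fst p))"]) simp
  qed
  ultimately have "\<exists>q. \<forall>k. ?P k (q k) \<and> ?R k (q k) (q (Suc k))"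
    by (rule dependent_nat_choice)
  then obtain q where q': "\<forall>k. ?P k (q k) \<and> ?R k (q k) (q (Suc k))" by (elim exE)
  have q: "?P k (q k)" "?R k (q k) (q (Suc k))" for k
    by (rule q'[THEN spec, THEN conjunct1], rule q'[THEN spec, THEN conjunct2])
  define \<nu> where "\<nu> k = fst (q k)" for k
  define s where "s k = snd (q k)" for k
  have \<nu>: "strict_mono \<nu>" using q(2) by (simp add: strict_mono_Suc_iff \<nu>_def)
  have s0: "0 \<le> s k" and sf: "dual_apply (f (\<nu> k)) (s k) < \<eta>" and \<epsilon>\<eta>: "\<epsilon> (\<nu> k) < \<eta>"
    and sS: "s (Suc k) = s k + a (\<nu> k)" for k
    using q by (auto simp: s_def \<nu>_def)
  have s_ge: "a (\<nu> j) \<le> s k" if "j < k" for j k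
    using that
  proof (induction k)
    case (Suc k)
    then show ?case using s0[of k] a(1)[of "\<nu> k"] sS[of k]
      by (cases "j = k") (auto intro: add_increasing add_increasing2)
  qed simp
  define w where "w k = pprt (a (\<nu> k) - t *\<^sub>R s k - (1/t) *\<^sub>R u)" for k
  have w0: "0 \<le> w k" for k by (simp add: w_def)
  have ts: "0 \<le> t *\<^sub>R s k" for k using t s0 by (simp add: scaleR_nonneg_nonneg)
  have tu: "0 \<le> (1/t) *\<^sub>R u" using t u by (simp add: scaleR_nonneg_nonneg)
  have w_le: "w k \<le> u" for k
  proof -
    have "a (\<nu> k) - (t *\<^sub>R s k + (1/t) *\<^sub>R u) \<le> a (\<nu> k) - 0"
      using ts tu by (intro diff_left_mono add_nonneg_nonneg)
    also have "\<dots> \<le> u" using a(2) by simp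
    finally show ?thesis unfolding w_def diff_diff_eq using u by (rule pprt_leI)
  qed
  have "disjoint_seq w"
  proof (rule disjoint_seqI[OF w0])
    fix j k :: nat assume "j < k"
    have "(1/t) *\<^sub>R a (\<nu> k) \<le> (1/t) *\<^sub>R u" using t a(2) by (intro scaleR_left_mono) auto
    then have 1: "w j \<le> pprt (a (\<nu> j) - (1/t) *\<^sub>R a (\<nu> k))"
      unfolding w_def diff_diff_eq using add_increasing[OF ts[of j]] by (intro pprt_mono diff_left_mono)
    have "t *\<^sub>R a (\<nu> j) \<le> t *\<^sub>R s k" using t s_ge[OF \<open>j < k\<close>] by (intro scaleR_left_mono) auto
    then have 2: "w k \<le> pprt (a (\<nu> k) - t *\<^sub>R a (\<nu> j))"
      unfolding w_def diff_diff_eq using add_increasing2[OF tu] by (intro pprt_mono diff_left_mono)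
    have "inf (pprt (a (\<nu> j) - (1/t) *\<^sub>R a (\<nu> k))) (pprt (a (\<nu> k) - t *\<^sub>R a (\<nu> j))) = 0"
      using t a(1) by (intro disjoint_pprt_diff) auto
    then show "inf (w j) (w k) = 0" using w0 1 w0 2 by (rule disjoint_mono)
  qed
  moreover have "bounded (range w)"
    using norm_mono_bl[OF w0 w_le] by (auto simp: bounded_iff)
  moreover have "\<delta> / 2 \<le> dual_apply (f (\<nu> k)) (w k)" for k
  proof -
    let ?F = "dual_apply (f (\<nu> k))"
    have "?F (a (\<nu> k)) - t * ?F (s k) - ?F u / t \<le> ?F (w k)"
      using dual.mono_right[OF f(1) le_pprt, of "\<nu> k" "a (\<nu> k) - t *\<^sub>R s k - (1/t) *\<^sub>R u"]
      by (simp add: w_def linear_diff[OF linear_dual_apply] linear_scale[OF linear_dual_apply])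
    moreover have "t * ?F (s k) \<le> t * \<eta>" using sf[of k] t by (intro mult_left_mono) auto
    moreover have "\<delta> - \<eta> \<le> ?F (a (\<nu> k))"
      using a1(2)[of "\<nu> k"] \<epsilon>\<eta>[of k] \<delta>(2)[of "\<nu> k"] by (simp add: linear_diff[OF linear_dual_apply])
    moreover have "?F u / t \<le> \<delta> / 8"
    proof -
      have "?F u \<le> C * norm u" using C(2)[of "\<nu> k" u] by simp
      also have "\<dots> \<le> \<delta> / 8 * t" using \<delta> by (simp add: t_def field_simps)
      finally show ?thesis using t by (simp add: field_simps)
    qed
    ultimately show ?thesis using \<eta> by linarith
  qed
  ultimately show thesis using that \<nu> w0 by blast
qed

text \<open>Choose \<open>y n\<close> in the unit ball on which \<open>f n\<close> attains at least
  \<open>\<delta> / 2\<close>. If truncation at some \<open>u\<close> eventually keeps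
  \<open>\<delta> / 4\<close>, the order bounded case applies to a tail. Otherwise every truncation
  frequently loses enough for splitting: the disjoint part keeps \<open>\<delta> / 8\<close> after
  the truncation and the error are removed.\<close>

lemma oc_dual_disjoint_witness:
  fixes f :: "nat \<Rightarrow> 'a::banach_lattice dual"
  assumes oc: "order_continuous_norm TYPE('a dual)"
    and f: "\<And>n. 0 \<le> f n" "disjoint_seq f" "bounded (range f)"
    and \<delta>: "0 < \<delta>" "\<And>n. \<delta> \<le> norm (f n)"
  obtains \<nu> y \<delta>' where "strict_mono \<nu>" "\<And>n. 0 \<le> y n" "disjoint_seq y" "bounded (range y)"
    "0 < \<delta>'" "\<And>n. \<delta>' \<le> dual_apply (f (\<nu> n)) (y n)"
proof -
  have "\<exists>y. 0 \<le> y \<and> norm y \<le> 1 \<and> \<delta> / 2 \<le> dual_apply (f n) y" for n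
  proof (rule dual_norming_positive[OF f(1), of "\<delta> / 2" n])
    show "\<delta> / 2 < norm (f n)" using \<delta>(1) \<delta>(2)[of n] by simp
  qed (use \<delta>(1) in auto)
  then obtain y where y: "\<And>n. 0 \<le> y n" "\<And>n. norm (y n) \<le> 1" "\<And>n. \<delta> / 2 \<le> dual_apply (f n) (y n)"
    by metis
  have bdy: "bounded (range y)" using y(2) by (auto simp: bounded_iff)
  show thesis
  proof (cases "\<exists>u\<ge>0. \<forall>\<^sub>F n in sequentially. \<delta> / 4 \<le> dual_apply (f n) (inf (y n) u)")
    case True
    then obtain u N where u: "0 \<le> u" and N: "\<And>n. n \<ge> N \<Longrightarrow> \<delta> / 4 \<le> dual_apply (f n) (inf (y n) u)"
      by (auto simp: eventually_sequentially)
    define g where "g n = f (n + N)" for n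
    have "\<delta> / 4 \<le> dual_apply (g n) u" for n
      using N[of "n + N"] dual.mono_right[OF f(1), of "inf (y (n + N)) u" u "n + N"] by (simp add: g_def)
    moreover have "disjoint_seq g" unfolding g_def by (rule disjoint_seq_subseq[OF f(2)]) (simp add: inj_def)
    moreover have "bounded (range g)" unfolding g_def by (rule bounded_subseq[OF f(3)])
    moreover have "0 \<le> g n" for n by (simp add: g_def f)
    moreover have "0 < \<delta> / 4" using \<delta> by simp
    ultimately obtain \<nu> w where w: "strict_mono \<nu>" "\<And>n. 0 \<le> w n" "disjoint_seq w" "bounded (range w)"
      "\<And>n. \<delta> / 4 / 2 \<le> dual_apply (g (\<nu> n)) (w n)"
      using oc_dual_disjoint_witness_order_bounded[OF oc _ _ _ u, of g "\<delta> / 4"] by blast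
    show thesis
    proof (rule that[of "\<lambda>n. \<nu> n + N" w "\<delta> / 8"])
      show "strict_mono (\<lambda>n. \<nu> n + N)" using w(1) by (simp add: strict_mono_def)
      show "\<delta> / 8 \<le> dual_apply (f (\<nu> n + N)) (w n)" for n using w(5)[of n] by (simp add: g_def)
    qed (use w \<delta> in auto)
  next
    case False
    then have fr: "\<exists>\<^sub>F n in sequentially. dual_apply (f n) (inf (y n) v) < \<delta> / 4" if "0 \<le> v" for v
      using that by (auto simp: frequently_def not_less)
    obtain \<nu> w v e where *: "strict_mono \<nu>" "disjoint_seq w" "\<And>k. 0 \<le> w k" "\<And>k. w k \<le> y (\<nu> k)"
      "\<And>k. 0 \<le> v k" "\<And>k. dual_apply (f (\<nu> k)) (inf (y (\<nu> k)) (v k)) < \<delta> / 4" "\<And>k. 0 \<le> e k"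
      "\<And>k. y (\<nu> k) \<le> v k + w k + e k" "e \<longlonglongrightarrow> 0"
      by (rule disjoint_splitting[OF y(1) bdy, where Q = "\<lambda>v n. dual_apply (f n) (inf (y n) v) < \<delta> / 4"])
        (erule fr, blast)
    have "\<forall>\<^sub>F k in sequentially. dual_apply (f (\<nu> k)) (e k) < \<delta> / 8"
      using dual.tendsto_zero_remainder[OF f(3) *(9), of \<nu>] \<delta>(1) by (intro order_tendstoD) auto
    then obtain N where N: "\<And>k. k \<ge> N \<Longrightarrow> dual_apply (f (\<nu> k)) (e k) < \<delta> / 8"
      by (auto simp: eventually_sequentially)
    have main: "\<delta> / 8 \<le> dual_apply (f (\<nu> k)) (w k)" if "k \<ge> N" for k
    proof -
      let ?F = "dual_apply (f (\<nu> k))"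
      have "pprt (y (\<nu> k) - v k) \<le> w k + e k"
        using *(3,7,8)[of k] by (intro pprt_leI) (simp_all add: algebra_simps)
      then have "?F (pprt (y (\<nu> k) - v k)) \<le> ?F (w k + e k)" using f(1) by (intro dual.mono_right)
      moreover have "?F (y (\<nu> k)) = ?F (inf (y (\<nu> k)) (v k)) + ?F (pprt (y (\<nu> k) - v k))"
        by (subst eq_inf_add_pprt[of "y (\<nu> k)" "v k"]) (rule linear_add[OF linear_dual_apply])
      ultimately show ?thesis
        using *(6)[of k] y(3)[of "\<nu> k"] N[OF that] by (simp add: linear_add[OF linear_dual_apply])
    qed
    have bw: "bounded (range w)"
      using order_trans[OF norm_mono_bl[OF *(3,4)] y(2)] by (auto simp: bounded_iff)
    show thesis
    proof (rule that[of "\<lambda>n. \<nu> (n + N)" "\<lambda>n. w (n + N)" "\<delta> / 8"])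
      show "strict_mono (\<lambda>n. \<nu> (n + N))" using *(1) by (simp add: strict_mono_def)
      show "disjoint_seq (\<lambda>n. w (n + N))" by (rule disjoint_seq_subseq[OF *(2)]) (simp add: inj_def)
      show "bounded (range (\<lambda>n. w (n + N)))" by (rule bounded_subseq[OF bw])
      show "\<delta> / 8 \<le> dual_apply (f (\<nu> (n + N))) (w (n + N))" for n by (rule main) simp
    qed (use *(3) \<delta> in auto)
  qed
qed

section \<open>Unbounded null sequences and the characterisation\<close>

lemma dual_summable_disjoint:
  fixes p :: "nat \<Rightarrow> 'a::banach_lattice"
  assumes p: "\<And>n. 0 \<le> p n" "disjoint_seq p" "\<And>n. p n \<le> u" and g: "0 \<le> g"
  shows "summable (\<lambda>n. dual_apply g (p n))"
proof (rule summableI_nonneg_bounded)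
  show "0 \<le> dual_apply g (p n)" for n using g p by (intro dual_nonneg_apply)
  fix n
  have "(\<Sum>i<n. p i) \<le> u" using p by (intro disjoint_sum_le) (auto simp: disjoint_seq_nonneg)
  then have "dual_apply g (\<Sum>i<n. p i) \<le> dual_apply g u" using g by (intro dual.mono_right)
  then show "(\<Sum>i<n. dual_apply g (p i)) \<le> dual_apply g u" by (simp add: linear_sum[OF linear_dual_apply])
qed

lemma inf_abs_truncation:
  fixes x :: "nat \<Rightarrow> 'a::banach_lattice"
  assumes "disjoint_seq x" "0 \<le> u"
  shows "disjoint_seq (\<lambda>n. inf \<bar>x n\<bar> u)" "0 \<le> inf \<bar>x n\<bar> u" "inf \<bar>x n\<bar> u \<le> u"
  using assms by (auto intro!: disjoint_seq_dominated[OF assms(1)] simp: abs_of_nonneg)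

text \<open>Truncations at \<open>u\<close> are disjoint and order bounded, so the values of
  \<open>\<bar>g\<bar>\<close> on them are summable.\<close>

lemma disjoint_seq_uaw_null:
  fixes x :: "nat \<Rightarrow> 'a::banach_lattice"
  assumes "disjoint_seq x"
  shows "uaw_null x"
  unfolding uaw_null_def uaw_convergent_def weakly_convergent_def
proof (intro allI impI)
  fix u :: 'a and g :: "'a dual" assume u: "0 \<le> u"
  note p = inf_abs_truncation[OF assms u]
  have "(\<lambda>n. dual_apply \<bar>g\<bar> (inf \<bar>x n\<bar> u)) \<longlonglongrightarrow> 0"
    by (intro summable_LIMSEQ_zero dual_summable_disjoint[OF p(2,1,3)]) simp
  moreover have "\<bar>dual_apply g (inf \<bar>x n\<bar> u)\<bar> \<le> dual_apply \<bar>g\<bar> (inf \<bar>x n\<bar> u)" for n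
    using dual.abs_le[of g "inf \<bar>x n\<bar> u"] p(2)[of n] by (simp add: abs_of_nonneg)
  ultimately have "(\<lambda>n. dual_apply g (inf \<bar>x n\<bar> u)) \<longlonglongrightarrow> 0"
    by - (rule Lim_null_comparison[OF always_eventually], auto)
  then show "(\<lambda>n. dual_apply g (inf \<bar>x n - 0\<bar> u)) \<longlonglongrightarrow> dual_apply g 0"
    by (simp add: linear_0[OF linear_dual_apply])
qed

lemma uaw_null_imp_uaw_star_null:
  fixes y :: "nat \<Rightarrow> 'a::banach_lattice dual"
  assumes "uaw_null y"
  shows "uaw_star_null y"
  unfolding uaw_star_null_def uaw_star_convergent_def weak_star_convergent_def
proof (intro allI impI)
  fix u :: "'a dual" and x :: 'a assume u: "0 \<le> u"
  \<comment> \<open>Evaluation at \<open>x\<close> is one of the functionals on the dual against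
    which weak convergence is tested.\<close>
  let ?e = "Dual (Blinfun (\<lambda>f. dual_apply f x))"
  have "(\<lambda>n. dual_apply ?e (inf \<bar>y n - 0\<bar> u)) \<longlonglongrightarrow> dual_apply ?e 0"
    using assms u unfolding uaw_null_def uaw_convergent_def weakly_convergent_def by blast
  then show "(\<lambda>n. dual_apply (inf \<bar>y n - 0\<bar> u) x) \<longlonglongrightarrow> dual_apply 0 x"
    unfolding dual_of_bounded_linear[OF dual.bounded_linear_left] .
qed

text \<open>The partial sums of the truncations \<open>p\<close> increase and stay below
  \<open>u\<close>, so they converge pointwise to a functional \<open>g\<close>. The remainders
  \<open>g - (\<Sum>i<n. p i)\<close> decrease to 0 and dominate every \<open>p k\<close> with
  \<open>k \<ge> n\<close>, which is order convergence.\<close>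

lemma disjoint_seq_uo_null_dual:
  fixes y :: "nat \<Rightarrow> 'a::banach_lattice dual"
  assumes "disjoint_seq y"
  shows "uo_null y"
  unfolding uo_null_def uo_convergent_def
proof (intro allI impI)
  fix u :: "'a dual" assume u: "0 \<le> u"
  define p where "p n = inf \<bar>y n\<bar> u" for n
  note p = inf_abs_truncation[OF assms u, folded p_def]
  have P_le: "(\<Sum>i<n. p i) \<le> u" for n
    using p by (intro disjoint_sum_le) (auto simp: disjoint_seq_nonneg)
  have P0: "0 \<le> (\<Sum>i<n. p i)" for n by (intro sum_nonneg p)
  have conv: "(\<lambda>n. dual_apply (\<Sum>i<n. p i) x) \<longlonglongrightarrow> (\<Sum>i. dual_apply (p i) x)" for x
  proof -
    have "summable (\<lambda>i. dual_apply (p i) \<bar>x\<bar>)"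
    proof (rule summableI_nonneg_bounded)
      show "0 \<le> dual_apply (p n) \<bar>x\<bar>" for n using p by (intro dual_nonneg_apply) auto
      show "(\<Sum>i<n. dual_apply (p i) \<bar>x\<bar>) \<le> dual_apply u \<bar>x\<bar>" for n
        using dual_le_apply[OF P_le[of n], of "\<bar>x\<bar>"] by (simp add: dual.sum_left)
    qed
    moreover have "norm (dual_apply (p i) x) \<le> dual_apply (p i) \<bar>x\<bar>" for i
      using dual.abs_le[of "p i" x] p(2)[of i] by (simp add: abs_of_nonneg)
    ultimately have "summable (\<lambda>i. dual_apply (p i) x)"
      by (intro summable_comparison_test[of "\<lambda>i. dual_apply (p i) x" "\<lambda>i. dual_apply (p i) \<bar>x\<bar>"]) auto
    then show ?thesis using summable_LIMSEQ by (simp add: dual.sum_left)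
  qed
  obtain g where "dual_apply g = (\<lambda>x. \<Sum>i. dual_apply (p i) x)"
    using dual_pointwise_limit[OF _ conv norm_mono_bl[OF P0 P_le]] by auto
  with conv have g: "(\<lambda>n. dual_apply (\<Sum>i<n. p i) x) \<longlonglongrightarrow> dual_apply g x" for x by simp
  have P_mono: "(\<Sum>i<m. p i) \<le> (\<Sum>i<n. p i)" if "m \<le> n" for m n
    using that p(2) by (intro sum_mono2) auto
  have P_le_g: "(\<Sum>i<n. p i) \<le> g" for n
    unfolding less_eq_dual_def
  proof (intro allI impI)
    fix x :: 'a assume "0 \<le> x"
    then show "dual_apply (\<Sum>i<n. p i) x \<le> dual_apply g x"
      by (intro incseq_le g) (auto intro!: dual_le_apply P_mono simp: incseq_def)
  qed
  have "net_decreases_to_0 UNIV (\<le>) (\<lambda>n. g - (\<Sum>i<n. p i))"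
    unfolding net_decreases_to_0_def directed_set_def
  proof (intro conjI ballI allI impI)
    fix z assume z: "\<forall>n\<in>UNIV. z \<le> g - (\<Sum>i<n. p i)"
    show "z \<le> 0"
      unfolding less_eq_dual_def
    proof (intro allI impI)
      fix x :: 'a assume "0 \<le> x"
      then have "dual_apply z x \<le> dual_apply g x - dual_apply (\<Sum>i<n. p i) x" for n
        using z dual_le_apply[of z "g - (\<Sum>i<n. p i)" x] by (simp add: dual_apply_diff)
      moreover have "(\<lambda>n. dual_apply g x - dual_apply (\<Sum>i<n. p i) x) \<longlonglongrightarrow> dual_apply g x - dual_apply g x"
        by (intro tendsto_diff g tendsto_const)
      ultimately show "dual_apply z x \<le> dual_apply 0 x"
        by (intro tendsto_lowerbound[of _ "dual_apply 0 x" sequentially]) (auto simp: dual_apply_zero)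
    qed
  qed (use P_le_g P_mono in \<open>auto intro: diff_left_mono max.cobounded1 max.cobounded2\<close>)
  moreover have "\<forall>n\<in>UNIV. \<forall>\<^sub>F k in sequentially. \<bar>inf \<bar>y k - 0\<bar> u - 0\<bar> \<le> g - (\<Sum>i<n. p i)"
  proof
    fix n
    show "\<forall>\<^sub>F k in sequentially. \<bar>inf \<bar>y k - 0\<bar> u - 0\<bar> \<le> g - (\<Sum>i<n. p i)"
      using eventually_ge_at_top[of n]
    proof eventually_elim
      case (elim k)
      have "(\<Sum>i<n. p i) + p k \<le> g"
        using order_trans[OF add_right_mono[OF P_mono[OF elim], of "p k"] P_le_g[of "Suc k", simplified]] .
      then show ?case using p(2)[of k] by (simp add: p_def abs_of_nonneg algebra_simps)
    qed
  qed
  ultimately show "order_convergent (\<lambda>n. inf \<bar>y n - 0\<bar> u) 0 sequentially"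
    by (rule order_convergent_any_index)
qed

text \<open>Because the dominating net is directed, its pointwise infimum on the cone is additive
  and so extends to a functional \<open>g\<close>. This lies below the whole net, hence
  \<open>g \<le> 0\<close>, and the net becomes small at \<open>x\<close>.\<close>

lemma order_null_dual_apply:
  fixes p :: "'i \<Rightarrow> 'a::banach_lattice dual"
  assumes "order_convergent p 0 F" and x: "0 \<le> x"
  shows "((\<lambda>i. dual_apply (p i) x) \<longlongrightarrow> 0) F"
proof (rule tendstoI)
  fix e :: real assume e: "0 < e"
  obtain B :: "'a dual set" and le q where net: "net_decreases_to_0 B le q"
    and p: "\<And>b. b \<in> B \<Longrightarrow> \<forall>\<^sub>F i in F. \<bar>p i\<bar> \<le> q b"
    using assms(1) unfolding order_convergent_def by auto
  have B: "B \<noteq> {}" and q0: "\<And>b. b \<in> B \<Longrightarrow> 0 \<le> q b"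
    and dir: "\<And>a b. a \<in> B \<Longrightarrow> b \<in> B \<Longrightarrow> \<exists>c\<in>B. q c \<le> q a \<and> q c \<le> q b"
    and inf: "\<And>z. (\<And>b. b \<in> B \<Longrightarrow> z \<le> q b) \<Longrightarrow> z \<le> 0"
    using net unfolding net_decreases_to_0_def directed_set_def by (blast, blast, meson, blast)
  define h where "h x = (INF b\<in>B. dual_apply (q b) x)" for x
  have bdd: "bdd_below ((\<lambda>b. dual_apply (q b) x) ` B)" if "0 \<le> x" for x
    using that by (intro bdd_belowI2[of _ 0] dual_nonneg_apply q0)
  have lower: "h x \<le> dual_apply (q b) x" if "0 \<le> x" "b \<in> B" for x b
    unfolding h_def using that by (intro cINF_lower bdd)
  have greatest: "m \<le> h x" if "\<And>b. b \<in> B \<Longrightarrow> m \<le> dual_apply (q b) x" for m x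
    unfolding h_def by (rule cINF_greatest[OF B]) (rule that)
  have h0: "0 \<le> h x" if "0 \<le> x" for x
    using that by (intro greatest dual_nonneg_apply q0)
  obtain b0 where b0: "b0 \<in> B" using B by blast
  have "\<exists>g. \<forall>x\<ge>0. dual_apply g x = h x"
  proof (rule dual_of_additive_on_cone[where K = "norm (q b0)"])
    fix x z :: 'a assume x: "0 \<le> x" and z: "0 \<le> z"
    show "h (x + z) = h x + h z"
    proof (rule antisym)
      have key: "h (x + z) \<le> dual_apply (q a) x + dual_apply (q b) z" if ab: "a \<in> B" "b \<in> B" for a b
      proof -
        obtain c where c: "c \<in> B" "q c \<le> q a" "q c \<le> q b" using dir[OF ab] by blast
        have "h (x + z) \<le> dual_apply (q c) (x + z)" using x z c by (intro lower) auto
        then show ?thesis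
          using dual_le_apply[OF c(2) x] dual_le_apply[OF c(3) z] by (simp add: linear_add[OF linear_dual_apply])
      qed
      have "h (x + z) - dual_apply (q a) x \<le> h z" if "a \<in> B" for a
        by (rule greatest) (use key[OF that] in \<open>simp add: algebra_simps\<close>)
      then have "h (x + z) - h z \<le> h x" by (intro greatest) (simp add: algebra_simps)
      then show "h (x + z) \<le> h x + h z" by simp
      show "h x + h z \<le> h (x + z)"
        by (rule greatest) (use lower x z in \<open>simp add: linear_add[OF linear_dual_apply] add_mono\<close>)
    qed
  next
    fix c :: real and x :: 'a assume c: "0 \<le> c" and x: "0 \<le> x"
    show "h (c *\<^sub>R x) = c * h x"
    proof (cases "c = 0")
      case True
      have "h 0 \<le> 0" using lower[OF order_refl b0] by (simp add: linear_0[OF linear_dual_apply])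
      with h0[of 0] True show ?thesis by simp
    next
      case False
      with c have c: "0 < c" by simp
      have cx: "0 \<le> c *\<^sub>R x" using c x by (simp add: scaleR_nonneg_nonneg)
      have "h (c *\<^sub>R x) / c \<le> h x"
      proof (rule greatest)
        fix b assume "b \<in> B"
        from lower[OF cx this] show "h (c *\<^sub>R x) / c \<le> dual_apply (q b) x"
          using c by (simp add: linear_scale[OF linear_dual_apply] field_simps)
      qed
      moreover have "c * h x \<le> h (c *\<^sub>R x)"
        by (rule greatest) (use lower[OF x] c in \<open>simp add: linear_scale[OF linear_dual_apply]\<close>)
      ultimately show ?thesis using c by (simp add: field_simps)
    qed
  next
    fix x :: 'a assume x: "0 \<le> x"
    show "\<bar>h x\<bar> \<le> norm (q b0) * norm x"
      using h0[OF x] lower[OF x b0] abs_dual_apply_le[of "q b0" x] by simp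
  qed
  then obtain g where g: "\<And>x. 0 \<le> x \<Longrightarrow> dual_apply g x = h x" by blast
  have "g \<le> 0" by (rule inf) (simp add: less_eq_dual_def g lower)
  then have "h x \<le> 0" using dual_le_apply[OF _ x, of g 0] g[OF x] by (simp add: dual_apply_zero)
  have "\<exists>b\<in>B. dual_apply (q b) x < e"
  proof (rule ccontr)
    assume "\<not> ?thesis"
    then have "e \<le> h x" by (intro greatest) (simp add: not_less)
    with \<open>h x \<le> 0\<close> e show False by simp
  qed
  then obtain b where b: "b \<in> B" "dual_apply (q b) x < e" by blast
  show "\<forall>\<^sub>F i in F. dist (dual_apply (p i) x) 0 < e"
    using p[OF b(1)]
  proof eventually_elim
    case (elim i)
    then show ?case
      using dual.abs_le[of "p i" x] dual_le_apply[OF elim x] b(2) x by (simp add: abs_of_nonneg)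
  qed
qed

section \<open>Tests for L-weak compactness\<close>

text \<open>A disjoint sequence in the solid hull that is not null has a subsequence bounded below
  in norm; \<open>z\<close> consists of its absolute values. Positivity gives
  \<open>\<bar>T v\<bar> \<le> T \<bar>v\<bar>\<close>, so the dominating elements \<open>w\<close>
  may be taken positive.\<close>

lemma not_L_weakly_compact_witness:
  fixes T :: "'a::banach_lattice \<Rightarrow> 'b::banach_lattice"
  assumes T: "positive_operator T" and "\<not> L_weakly_compact T"
  obtains z w \<delta> where "disjoint_seq z" "\<And>n. 0 \<le> z n" "\<And>n. 0 \<le> w n" "\<And>n. norm (w n) \<le> 1"
    "\<And>n. z n \<le> T (w n)" "0 < \<delta>" "\<And>n. \<delta> \<le> norm (z n)" "bounded (range z)"
proof -
  note pT = positive_operatorD[OF T] and bT = positive_operator_bounded[OF T]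
  have bd: "bounded (T ` cball 0 1)" by (rule bounded_linear_image[OF bounded_cball bT])
  with assms(2) bT obtain x where x: "disjoint_seq x" "range x \<subseteq> solid hull (T ` cball 0 1)" "\<not> x \<longlonglongrightarrow> 0"
    by (auto simp: L_weakly_compact_def L_weakly_compact_set_def)
  obtain \<delta> where \<delta>: "0 < \<delta>" "\<not> eventually (\<lambda>n. norm (x n) < \<delta>) sequentially"
    using x(3) unfolding tendsto_iff by auto
  obtain r :: "nat \<Rightarrow> nat" where r: "strict_mono r" "\<And>n. \<delta> \<le> norm (x (r n))"
    using not_eventually_sequentiallyD[OF \<delta>(2)] by (auto simp: not_less)
  have "\<exists>v. norm v \<le> 1 \<and> \<bar>x (r n)\<bar> \<le> \<bar>T v\<bar>" for n
  proof -
    have "x (r n) \<in> solid hull (T ` cball 0 1)" using x(2) by blast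
    then show ?thesis unfolding mem_solid_hull by auto
  qed
  then obtain v where v: "\<And>n. norm (v n) \<le> 1" "\<And>n. \<bar>x (r n)\<bar> \<le> \<bar>T (v n)\<bar>" by metis
  have le: "\<bar>x (r n)\<bar> \<le> T \<bar>v n\<bar>" for n using v(2) pT(4) by (rule order_trans)
  obtain K where K: "\<And>y. norm (T y) \<le> norm y * K" "0 < K" using bounded_linear.pos_bounded[OF bT] by blast
  have "norm (x (r n)) \<le> K" for n
  proof -
    have "norm (x (r n)) \<le> norm (T (v n))" using v(2) by (rule norm_mono_abs)
    also have "\<dots> \<le> norm (v n) * K" by (rule K)
    also have "\<dots> \<le> 1 * K" using v(1) K(2) by (intro mult_right_mono) auto
    finally show ?thesis by simp
  qed
  then have bz: "bounded (range (\<lambda>n. \<bar>x (r n)\<bar>))" by (auto simp: bounded_iff)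
  have dz: "disjoint_seq (\<lambda>n. \<bar>x (r n)\<bar>)"
    by (rule disjoint_seq_dominated[OF disjoint_seq_subseq[OF x(1) strict_mono_imp_inj_on[OF r(1)]]]) simp
  show thesis
    by (rule that[OF dz _ _ _ le \<delta>(1) _ bz]) (use v r in auto)
qed

text \<open>Norming functionals of the \<open>z n\<close>, cut down to the carriers of the
  \<open>z n\<close>, become disjoint without changing their value at \<open>z n\<close>. Order
  continuity makes them null at fixed elements, and \<open>disjoint_witness\<close> then turns
  \<open>w\<close> into a disjoint sequence that violates the test.\<close>

lemma L_weakly_compact_if_disjoint_test:
  fixes T :: "'e::banach_lattice \<Rightarrow> 'f::banach_lattice"
  assumes oc: "order_continuous_norm TYPE('f)" and T: "positive_operator T"
    and test: "\<And>x y'. \<lbrakk>pos_disjoint_ball_seq x; bounded (range y'); disjoint_seq y'\<rbrakk>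
      \<Longrightarrow> (\<lambda>n. dual_apply (y' n) (T (x n))) \<longlonglongrightarrow> 0"
  shows "L_weakly_compact T"
proof (rule ccontr)
  assume "\<not> ?thesis"
  then obtain z w \<delta> where z: "disjoint_seq z" "\<And>n. 0 \<le> z n" and w: "\<And>n. 0 \<le> w n" "\<And>n. norm (w n) \<le> 1"
    and zw: "\<And>n. z n \<le> T (w n)" and \<delta>: "0 < \<delta>" "\<And>n. \<delta> \<le> norm (z n)"
    using not_L_weakly_compact_witness[OF T, of thesis] by metis
  have "\<exists>f. 0 \<le> f \<and> norm f \<le> 1 \<and> dual_apply f (z n) = norm (z n)" for n
    using positive_norming_functional[OF z(2)[of n]] by metis
  then obtain f where f: "\<And>n. 0 \<le> f n" "\<And>n. norm (f n) \<le> 1" "\<And>n. dual_apply (f n) (z n) = norm (z n)"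
    by metis
  define h where "h n = carrier_part (f n) (z n)" for n
  have h0: "0 \<le> h n" for n using f z by (simp add: h_def carrier_part_nonneg)
  have hdisj: "disjoint_seq h"
    unfolding disjoint_seq_nonneg[of h, OF h0]
    using f z by (auto simp: h_def disjoint_seq_nonneg intro!: carrier_part_disjoint)
  have "norm (h n) \<le> 1" for n
    using norm_mono_bl[OF h0, of n "f n"] f(2)[of n] carrier_part_le[OF f(1) z(2), of n n] by (simp add: h_def)
  then have hb: "bounded (range h)" by (auto simp: bounded_iff)
  have "\<delta> \<le> dual_apply (h n) (T (w n))" for n
    using dual.mono_right[OF h0 zw, of n n] \<delta>(2)[of n] f z by (simp add: h_def carrier_part_self)
  from dual.disjoint_witness[OF T w h0 hb oc_dual_disjoint_pointwise_null[OF oc h0 hdisj hb] \<delta>(1) this]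
  obtain x \<nu> where "strict_mono \<nu>" "pos_disjoint_ball_seq x"
    "\<not> (\<lambda>n. dual_apply (h (\<nu> n)) (T (x n))) \<longlonglongrightarrow> 0" by metis
  with test[of x "\<lambda>n. h (\<nu> n)"] hb hdisj show False
    by (metis bounded_subseq disjoint_seq_subseq strict_mono_imp_inj_on)
qed

text \<open>Here the \<open>z n\<close> are functionals and the test sequence lies in the predual,
  where norming elements cannot simply be cut to carriers; \<open>oc_dual_disjoint_witness\<close>
  supplies disjoint ones along a subsequence.\<close>

lemma L_weakly_compact_if_disjoint_test_dual:
  fixes S :: "'e::banach_lattice \<Rightarrow> 'f::banach_lattice dual"
  assumes oc: "order_continuous_norm TYPE('f dual)" and S: "positive_operator S"
    and test: "\<And>x y. \<lbrakk>pos_disjoint_ball_seq x; bounded (range y); disjoint_seq y\<rbrakk>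
      \<Longrightarrow> (\<lambda>n. dual_apply (S (x n)) (y n)) \<longlonglongrightarrow> 0"
  shows "L_weakly_compact S"
proof (rule ccontr)
  assume "\<not> ?thesis"
  then obtain z w \<delta> where z: "disjoint_seq z" "\<And>n. 0 \<le> z n" "bounded (range z)"
    and w: "\<And>n. 0 \<le> w n" "\<And>n. norm (w n) \<le> 1"
    and zw: "\<And>n. z n \<le> S (w n)" and \<delta>: "0 < \<delta>" "\<And>n. \<delta> \<le> norm (z n)"
    using not_L_weakly_compact_witness[OF S, of thesis] by metis
  obtain \<nu> y \<delta>' where "strict_mono \<nu>" and y: "\<And>n. 0 \<le> y n" "disjoint_seq y" "bounded (range y)"
    and \<delta>': "0 < \<delta>'" "\<And>n. \<delta>' \<le> dual_apply (z (\<nu> n)) (y n)"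
    using oc_dual_disjoint_witness[OF oc z(2,1,3) \<delta>] by metis
  have "\<delta>' \<le> dual_apply (S (w (\<nu> n))) (y n)" for n
    using \<delta>'(2)[of n] dual_le_apply[OF zw y(1)] order_trans by blast
  from predual.disjoint_witness[OF S w(1) w(2) y(1,3) oc_dual_disjoint_weakly_null[OF oc y] \<delta>'(1) this]
  obtain x \<mu> where "strict_mono \<mu>" "pos_disjoint_ball_seq x"
    "\<not> (\<lambda>n. dual_apply (S (x n)) (y (\<mu> n))) \<longlonglongrightarrow> 0" by metis
  with test[of x "\<lambda>n. y (\<mu> n)"] y show False
    by (metis bounded_subseq disjoint_seq_subseq strict_mono_imp_inj_on)
qed

text \<open>As \<open>T (x n)\<close> is positive, the pairing is dominated by that of
  \<open>\<bar>y n\<bar>\<close>, to which \<open>null_of_disjoint_null\<close> applies.\<close>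

lemma (in lattice_pairing) L_weakly_compact_imp_null:
  fixes T :: "'e::banach_lattice \<Rightarrow> 'g"
  assumes T: "positive_operator T" "L_weakly_compact T" and x: "pos_disjoint_ball_seq x"
    and y: "bounded (range y)"
    and disj: "\<And>h u. \<lbrakk>\<And>n::nat. 0 \<le> h n; disjoint_seq h; bounded (range h); 0 \<le> u\<rbrakk> \<Longrightarrow> (\<lambda>n. B (h n) u) \<longlonglongrightarrow> 0"
    and null: "\<And>v u. \<lbrakk>0 \<le> v; 0 \<le> u\<rbrakk> \<Longrightarrow> (\<lambda>n. B (inf \<bar>y n\<bar> v) u) \<longlonglongrightarrow> 0"
  shows "(\<lambda>n. B (y n) (T (x n))) \<longlonglongrightarrow> 0"
proof -
  have Tx: "0 \<le> T (x n)" for n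
    using x by (intro positive_operatorD(2)[OF T(1)]) (simp add: pos_disjoint_ball_seq_def)
  have "(\<lambda>n. B \<bar>y n\<bar> (T (x n))) \<longlonglongrightarrow> 0"
  proof (rule null_of_disjoint_null[OF _ _ Tx _ _ disj null])
    show "L_weakly_compact_set (T ` cball 0 1)" using T(2) by (simp add: L_weakly_compact_def)
    show "T (x n) \<in> T ` cball 0 1" for n using x by (intro imageI) (unfold pos_disjoint_ball_seq_def, blast)
    show "bounded (range (\<lambda>n. \<bar>y n\<bar>))" using y by (simp add: bounded_iff)
  qed auto
  moreover have "norm (B (y n) (T (x n))) \<le> B \<bar>y n\<bar> (T (x n))" for n
    using abs_le[of "y n" "T (x n)"] Tx[of n] by (simp add: abs_of_nonneg)
  ultimately show ?thesis by - (rule Lim_null_comparison[OF always_eventually], auto)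
qed

theorem theorem2p6:
  shows "(\<forall>T :: 'e::banach_lattice \<Rightarrow> 'f::banach_lattice.
      positive_operator T \<longrightarrow> order_continuous_norm TYPE('f) \<longrightarrow>
        (let a = L_weakly_compact T;
             b = (\<forall>x y'. pos_disjoint_ball_seq x \<longrightarrow> bounded (range y') \<longrightarrow> uaw_star_null y' \<longrightarrow>
                    (\<lambda>n. dual_apply (y' n) (T (x n))) \<longlonglongrightarrow> 0);
             c = (\<forall>x y'. pos_disjoint_ball_seq x \<longrightarrow> bounded (range y') \<longrightarrow> uaw_null y' \<longrightarrow>
                    (\<lambda>n. dual_apply (y' n) (T (x n))) \<longlonglongrightarrow> 0);
             d = (\<forall>x y'. pos_disjoint_ball_seq x \<longrightarrow> bounded (range y') \<longrightarrow> uo_null y' \<longrightarrow>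
                    (\<lambda>n. dual_apply (y' n) (T (x n))) \<longlonglongrightarrow> 0)
         in (a \<longleftrightarrow> b) \<and> (a \<longleftrightarrow> c) \<and> (a \<longleftrightarrow> d)))
    \<and> (\<forall>S :: 'e \<Rightarrow> 'f dual.
      positive_operator S \<longrightarrow> order_continuous_norm TYPE('f dual) \<longrightarrow>
        (L_weakly_compact S \<longleftrightarrow>
          (\<forall>x y. pos_disjoint_ball_seq x \<longrightarrow> bounded (range y) \<longrightarrow> uaw_null y \<longrightarrow>
            (\<lambda>n. dual_apply (S (x n)) (y n)) \<longlonglongrightarrow> 0)))"
proof (intro conjI allI impI)
  fix T :: "'e \<Rightarrow> 'f"
  assume T: "positive_operator T" and oc: "order_continuous_norm TYPE('f)"
  let ?test = "\<lambda>null. \<forall>x (y' :: nat \<Rightarrow> 'f dual). pos_disjoint_ball_seq x \<longrightarrow> bounded (range y') \<longrightarrow>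
    null y' \<longrightarrow> (\<lambda>n. dual_apply (y' n) (T (x n))) \<longlonglongrightarrow> 0"
  \<comment> \<open>All three notions of null sequence enter through the same two properties:
    disjoint sequences have them, and they make truncations tend to 0 at each positive
    element.\<close>
  have equiv: "L_weakly_compact T \<longleftrightarrow> ?test null"
    if disj: "\<And>y'. disjoint_seq y' \<Longrightarrow> null y'"
      and ap: "\<And>y' v u. \<lbrakk>null y'; 0 \<le> v; 0 \<le> u\<rbrakk> \<Longrightarrow> (\<lambda>n. dual_apply (inf \<bar>y' n\<bar> v) u) \<longlonglongrightarrow> 0" for null
  proof
    assume "L_weakly_compact T"
    then show "?test null"
      using dual.L_weakly_compact_imp_null[OF T] oc_dual_disjoint_pointwise_null[OF oc] ap by blast
  next
    assume "?test null"
    then show "L_weakly_compact T"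
      using disj by (intro L_weakly_compact_if_disjoint_test[OF oc T]) blast
  qed
  have star: "(\<lambda>n. dual_apply (inf \<bar>y' n\<bar> v) u) \<longlonglongrightarrow> 0" if "uaw_star_null y'" "0 \<le> v" for y' :: "nat \<Rightarrow> 'f dual" and v u
    using that by (simp add: uaw_star_null_def uaw_star_convergent_def weak_star_convergent_def dual_apply_zero)
  have uo: "(\<lambda>n. dual_apply (inf \<bar>y' n\<bar> v) u) \<longlonglongrightarrow> 0" if "uo_null y'" "0 \<le> v" "0 \<le> u" for y' :: "nat \<Rightarrow> 'f dual" and v u
    using that by (intro order_null_dual_apply) (simp_all add: uo_null_def uo_convergent_def)
  have "L_weakly_compact T \<longleftrightarrow> ?test uaw_star_null"
    by (rule equiv) (auto intro: star uaw_null_imp_uaw_star_null disjoint_seq_uaw_null)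
  moreover have "L_weakly_compact T \<longleftrightarrow> ?test uaw_null"
    by (rule equiv) (auto intro: star uaw_null_imp_uaw_star_null disjoint_seq_uaw_null)
  moreover have "L_weakly_compact T \<longleftrightarrow> ?test uo_null"
    by (rule equiv) (auto intro: uo disjoint_seq_uo_null_dual)
  ultimately show "let a = L_weakly_compact T; b = ?test uaw_star_null; c = ?test uaw_null; d = ?test uo_null
    in (a \<longleftrightarrow> b) \<and> (a \<longleftrightarrow> c) \<and> (a \<longleftrightarrow> d)"
    unfolding Let_def by blast
next
  fix S :: "'e \<Rightarrow> 'f dual"
  assume S: "positive_operator S" and oc: "order_continuous_norm TYPE('f dual)"
  let ?test = "\<forall>x y. pos_disjoint_ball_seq x \<longrightarrow> bounded (range y) \<longrightarrow> uaw_null y \<longrightarrow>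
    (\<lambda>n. dual_apply (S (x n)) (y n)) \<longlonglongrightarrow> 0"
  show "L_weakly_compact S \<longleftrightarrow> ?test"
  proof
    assume L: "L_weakly_compact S"
    show ?test
    proof (intro allI impI)
      fix x :: "nat \<Rightarrow> 'e" and y :: "nat \<Rightarrow> 'f"
      assume x: "pos_disjoint_ball_seq x" and y: "bounded (range y)" "uaw_null y"
      show "(\<lambda>n. dual_apply (S (x n)) (y n)) \<longlonglongrightarrow> 0"
      proof (rule predual.L_weakly_compact_imp_null[OF S L x y(1) oc_dual_disjoint_weakly_null[OF oc]])
        fix v :: 'f and u :: "'f dual" assume "0 \<le> v"
        then show "(\<lambda>n. dual_apply u (inf \<bar>y n\<bar> v)) \<longlonglongrightarrow> 0"
          using y(2) by (simp add: uaw_null_def uaw_convergent_def weakly_convergent_def linear_0[OF linear_dual_apply])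
      qed
    qed
  next
    assume ?test
    then show "L_weakly_compact S"
      using disjoint_seq_uaw_null by (intro L_weakly_compact_if_disjoint_test_dual[OF oc S]) blast
  qed
qed

end
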